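(* The partial tensor operad $\underline{\mathbb R}=\big(\{\mathbb R^n\}_{n\ge1},\{\otimes_i\}\big)$ is isomorphic to the suboperad of additive games of the operad $\mathbb G$ of cooperative games, and thus in turn isomorphic to the permutative operad $\mathcal{P}erm$.
   Context: Operads are symmetric operads in real vector spaces. Partial tensor operad: $\mathbb R^n$, $n\ge1$, with $\mathbb S_n$ permuting the standard basis ($\sigma\star e_j=e_{\sigma(j)}$), and, for $x\in\mathbb R^n$, $y\in\mathbb R^k$, $i\in[n]$, with $\eta=\sum_{l}y_l$, $$x\otimes_iy=(\eta x_1,\dots,\eta x_{i-1},x_iy_1,\dots,x_iy_k,\eta x_{i+1},\dots,\eta x_n)\in\mathbb R^{n+k-1};$$ the unit is $1\in\mathbb R^1$. Operad of games: $\mathbb G(n)$ is the vector space of functions $v:\mathcal P([n])\to\mathbb R$ with $v(\emptyset)=0$, with $(\sigma\star v)(S)=v(\sigma^{-1}(S))$. For $\alpha$ on the ordered player set $A$, $\beta$ on the ordered player set $B$ (disjoint), $i\in A$, the game $\alpha\circ_i\beta$ has player set $(A\setminus\{i\})\cup B$ ($B$ inserted in order in the place of $i$) and $$(\alpha\circ_i\beta)(S)=\beta(B)\alpha(S\cap A)+\partial_i\alpha(S\cap A)\,\beta(S\cap B),\qquad \partial_i\alpha(T)=\alpha(T\cup\{i\})-\alpha(T\setminus\{i\});$$ the unit is the $1$-player game with value $1$. A game $(N,v)$ is additive if $v(S)=\sum_{j\in S}v(\{j\})$ for all $S\subseteq N$. $\mathcal{P}erm$ is the operad generated by one arity $2$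 operation $\rho$ without symmetry (generating the regular representation of $\mathbb S_2$) with relations $\rho\circ_1\rho=\rho\circ_2\rho=\rho\circ_2((21)\star\rho)$. *)

theory Defs
  imports
    "HOL-Algebra.AbelCoset"
    "HOL-Algebra.Module"
    "HOL-Algebra.Algebraic_Closure_Type"
    "HOL-Combinatorics.Permutations"
begin

section \<open>Symmetric operads in real vector spaces\<close>

abbreviation real_field :: "real ring" where
  "real_field \<equiv> ring_of_type_algebra"

definition linear_map ::
    "(real, 'a) module \<Rightarrow> (real, 'b) module \<Rightarrow> ('a \<Rightarrow> 'b) \<Rightarrow> bool" where
  "linear_map V W f \<longleftrightarrow>
     f \<in> carrier V \<rightarrow> carrier W \<and>
     (\<forall>x\<in>carrier V. \<forall>y\<in>carrier V. f (x \<oplus>\<^bsub>V\<^esub> y) = f x \<oplus>\<^bsub>W\<^esub> f y) \<and>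
     (\<forall>c. \<forall>x\<in>carrier V. f (c \<odot>\<^bsub>V\<^esub> x) = c \<odot>\<^bsub>W\<^esub> f x)"

text \<open>
  Arities are the natural numbers \<open>n \<ge> 1\<close>; whatever a record contains in arity \<open>0\<close> is
  irrelevant. Inputs of an \<open>n\<close>-ary operation are numbered \<open>1, \<dots>, n\<close>.
  \<open>opact P n \<sigma> x\<close> is the left action of \<open>\<sigma>\<close> on an \<open>n\<close>-ary \<open>x\<close>, and
  \<open>opcomp P n k i x y\<close> is the partial composition of an \<open>n\<close>-ary \<open>x\<close> with a
  \<open>k\<close>-ary \<open>y\<close> at input \<open>i\<close>.
\<close>

record 'a operad =
  opspace :: "nat \<Rightarrow> (real, 'a) module"
  opact :: "nat \<Rightarrow> (nat \<Rightarrow> nat) \<Rightarrow> 'a \<Rightarrow> 'a"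
  opcomp :: "nat \<Rightarrow> nat \<Rightarrow> nat \<Rightarrow> 'a \<Rightarrow> 'a \<Rightarrow> 'a"
  opunit :: 'a

abbreviation ops :: "'a operad \<Rightarrow> nat \<Rightarrow> 'a set" where
  "ops P n \<equiv> carrier (opspace P n)"

text \<open>
  When \<open>k\<close> inputs are inserted in the place of input \<open>i\<close>, the old input \<open>j \<noteq> i\<close>
  becomes number \<open>outer_pos i k j\<close>, and the \<open>q\<close>-th inserted input becomes number
  \<open>inner_pos i q\<close>.
\<close>

definition outer_pos :: "nat \<Rightarrow> nat \<Rightarrow> nat \<Rightarrow> nat" where
  "outer_pos i k j = (if j < i then j else j + k - 1)"

definition inner_pos :: "nat \<Rightarrow> nat \<Rightarrow> nat" where
  "inner_pos i q = i + q - 1"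

text \<open>
  The permutation of the inputs of \<open>x \<circ>\<^sub>i y\<close> induced by \<open>\<sigma>\<close> on the inputs of \<open>x\<close> and
  \<open>\<tau>\<close> on those of \<open>y\<close>: it sends \<open>outer_pos i k j\<close> to \<open>outer_pos (\<sigma> i) k (\<sigma> j)\<close> and
  \<open>inner_pos i q\<close> to \<open>inner_pos (\<sigma> i) (\<tau> q)\<close>.
\<close>

definition perm_comp ::
    "nat \<Rightarrow> nat \<Rightarrow> nat \<Rightarrow> (nat \<Rightarrow> nat) \<Rightarrow> (nat \<Rightarrow> nat) \<Rightarrow> nat \<Rightarrow> nat" where
  "perm_comp n k i \<sigma> \<tau> p =
     (if p \<notin> {1..n + k - 1} then p
      else if p < i then outer_pos (\<sigma> i) k (\<sigma> p)
      else if p < i + k then inner_pos (\<sigma> i) (\<tau> (p + 1 - i))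
      else outer_pos (\<sigma> i) k (\<sigma> (p + 1 - k)))"

locale operad =
  fixes P :: "'a operad"
  assumes vector_space: "n \<ge> 1 \<Longrightarrow> module real_field (opspace P n)"
    and act_linear:
      "\<lbrakk>n \<ge> 1; \<sigma> permutes {1..n}\<rbrakk> \<Longrightarrow>
       linear_map (opspace P n) (opspace P n) (opact P n \<sigma>)"
    and act_id: "\<lbrakk>n \<ge> 1; x \<in> ops P n\<rbrakk> \<Longrightarrow> opact P n id x = x"
    and act_comp:
      "\<lbrakk>n \<ge> 1; \<sigma> permutes {1..n}; \<tau> permutes {1..n}; x \<in> ops P n\<rbrakk> \<Longrightarrow>
       opact P n (\<sigma> \<circ> \<tau>) x = opact P n \<sigma> (opact P n \<tau> x)"
    and comp_linear_left:
      "\<lbrakk>n \<ge> 1; k \<ge> 1; i \<in> {1..n}; y \<in> ops P k\<rbrakk> \<Longrightarrow>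
       linear_map (opspace P n) (opspace P (n + k - 1)) (\<lambda>x. opcomp P n k i x y)"
    and comp_linear_right:
      "\<lbrakk>n \<ge> 1; k \<ge> 1; i \<in> {1..n}; x \<in> ops P n\<rbrakk> \<Longrightarrow>
       linear_map (opspace P k) (opspace P (n + k - 1)) (\<lambda>y. opcomp P n k i x y)"
    and unit_closed: "opunit P \<in> ops P 1"
    and unit_left: "\<lbrakk>n \<ge> 1; x \<in> ops P n\<rbrakk> \<Longrightarrow> opcomp P 1 n 1 (opunit P) x = x"
    and unit_right:
      "\<lbrakk>n \<ge> 1; i \<in> {1..n}; x \<in> ops P n\<rbrakk> \<Longrightarrow> opcomp P n 1 i x (opunit P) = x"
    and comp_sequential:
      "\<lbrakk>n \<ge> 1; k \<ge> 1; m \<ge> 1; i \<in> {1..n}; j \<in> {1..k};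
        x \<in> ops P n; y \<in> ops P k; z \<in> ops P m\<rbrakk> \<Longrightarrow>
       opcomp P (n + k - 1) m (inner_pos i j) (opcomp P n k i x y) z =
       opcomp P n (k + m - 1) i x (opcomp P k m j y z)"
    and comp_parallel:
      "\<lbrakk>n \<ge> 1; k \<ge> 1; m \<ge> 1; i \<in> {1..n}; l \<in> {1..n}; i < l;
        x \<in> ops P n; y \<in> ops P k; z \<in> ops P m\<rbrakk> \<Longrightarrow>
       opcomp P (n + k - 1) m (outer_pos i k l) (opcomp P n k i x y) z =
       opcomp P (n + m - 1) k i (opcomp P n m l x z) y"
    and comp_equivariant:
      "\<lbrakk>n \<ge> 1; k \<ge> 1; i \<in> {1..n}; \<sigma> permutes {1..n}; \<tau> permutes {1..k};
        x \<in> ops P n; y \<in> ops P k\<rbrakk> \<Longrightarrow>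
       opcomp P n k (\<sigma> i) (opact P n \<sigma> x) (opact P k \<tau> y) =
       opact P (n + k - 1) (perm_comp n k i \<sigma> \<tau>) (opcomp P n k i x y)"

definition operad_iso :: "'a operad \<Rightarrow> 'b operad \<Rightarrow> (nat \<Rightarrow> 'a \<Rightarrow> 'b) \<Rightarrow> bool" where
  "operad_iso P Q \<phi> \<longleftrightarrow>
     (\<forall>n\<ge>1. linear_map (opspace P n) (opspace Q n) (\<phi> n) \<and>
             bij_betw (\<phi> n) (ops P n) (ops Q n)) \<and>
     (\<forall>n\<ge>1. \<forall>\<sigma>. \<sigma> permutes {1..n} \<longrightarrow>
        (\<forall>x\<in>ops P n. \<phi> n (opact P n \<sigma> x) = opact Q n \<sigma> (\<phi> n x))) \<and>
     (\<forall>n\<ge>1. \<forall>k\<ge>1. \<forall>i\<in>{1..n}. \<forall>x\<in>ops P n. \<forall>y\<in>ops P k.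
        \<phi> (n + k - 1) (opcomp P n k i x y) = opcomp Q n k i (\<phi> n x) (\<phi> k y)) \<and>
     \<phi> 1 (opunit P) = opunit Q"

definition operad_isomorphic :: "'a operad \<Rightarrow> 'b operad \<Rightarrow> bool" (infix \<open>\<cong>\<^sub>o\<^sub>p\<close> 50) where
  "P \<cong>\<^sub>o\<^sub>p Q \<longleftrightarrow> operad P \<and> operad Q \<and> (\<exists>\<phi>. operad_iso P Q \<phi>)"

definition suboperad :: "'a operad \<Rightarrow> (nat \<Rightarrow> 'a set) \<Rightarrow> bool" where
  "suboperad P H \<longleftrightarrow> operad P \<and>
     (\<forall>n\<ge>1. submodule (H n) real_field (opspace P n)) \<and>
     (\<forall>n\<ge>1. \<forall>\<sigma>. \<sigma> permutes {1..n} \<longrightarrow> (\<forall>x\<in>H n. opact P n \<sigma> x \<in> H n)) \<and>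
     (\<forall>n\<ge>1. \<forall>k\<ge>1. \<forall>i\<in>{1..n}. \<forall>x\<in>H n. \<forall>y\<in>H k.
        opcomp P n k i x y \<in> H (n + k - 1)) \<and>
     opunit P \<in> H 1"

definition restrict_operad :: "'a operad \<Rightarrow> (nat \<Rightarrow> 'a set) \<Rightarrow> 'a operad" where
  "restrict_operad P H = P\<lparr>opspace := \<lambda>n. (opspace P n)\<lparr>carrier := H n\<rparr>\<rparr>"


section \<open>Operadic ideals and quotients\<close>

definition operad_ideal :: "'a operad \<Rightarrow> (nat \<Rightarrow> 'a set) \<Rightarrow> bool" where
  "operad_ideal P I \<longleftrightarrow>
     (\<forall>n\<ge>1. submodule (I n) real_field (opspace P n)) \<and>
     (\<forall>n\<ge>1. \<forall>\<sigma>. \<sigma> permutes {1..n} \<longrightarrow> (\<forall>x\<in>I n. opact P n \<sigma> x \<in> I n)) \<and>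
     (\<forall>n\<ge>1. \<forall>k\<ge>1. \<forall>i\<in>{1..n}.
        (\<forall>x\<in>I n. \<forall>y\<in>ops P k. opcomp P n k i x y \<in> I (n + k - 1)) \<and>
        (\<forall>x\<in>ops P n. \<forall>y\<in>I k. opcomp P n k i x y \<in> I (n + k - 1)))"

definition generated_ideal :: "'a operad \<Rightarrow> (nat \<Rightarrow> 'a set) \<Rightarrow> nat \<Rightarrow> 'a set" where
  "generated_ideal P R n = \<Inter>{I n | I. operad_ideal P I \<and> (\<forall>m\<ge>1. R m \<subseteq> I m)}"

text \<open>
  The operations on cosets are unions of cosets over all representatives; for an ideal
  \<open>I\<close> each of these unions is a single coset. The fields \<open>mult\<close> and \<open>one\<close>, which the type
  of modules inherits from rings, play no role for modules.
\<close>

definition quotient_operad :: "'a operad \<Rightarrow> (nat \<Rightarrow> 'a set) \<Rightarrow> 'a set operad" where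
  "quotient_operad P I =
     \<lparr>opspace = (\<lambda>n.
        \<lparr>carrier = a_rcosets\<^bsub>opspace P n\<^esub> (I n), monoid.mult = undefined, one = undefined,
         zero = I n, add = set_add (opspace P n),
         module.smult = (\<lambda>c A. \<Union>a\<in>A. I n +>\<^bsub>opspace P n\<^esub> (c \<odot>\<^bsub>opspace P n\<^esub> a))\<rparr>),
      opact = (\<lambda>n \<sigma> A. \<Union>a\<in>A. I n +>\<^bsub>opspace P n\<^esub> opact P n \<sigma> a),
      opcomp = (\<lambda>n k i A B. \<Union>a\<in>A. \<Union>b\<in>B.
        I (n + k - 1) +>\<^bsub>opspace P (n + k - 1)\<^esub> opcomp P n k i a b),
      opunit = I 1 +>\<^bsub>opspace P 1\<^esub> opunit P\<rparr>"


section \<open>The partial tensor operad\<close>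

text \<open>
  The vector space of real functions on \<open>A\<close>, each one extended by \<open>0\<close> outside \<open>A\<close>.
\<close>

definition function_space :: "'b set \<Rightarrow> (real, 'b \<Rightarrow> real) module" where
  "function_space A =
     \<lparr>carrier = {f. \<forall>x. x \<notin> A \<longrightarrow> f x = 0}, monoid.mult = undefined, one = undefined,
      zero = (\<lambda>x. 0), add = (\<lambda>f g x. f x + g x), module.smult = (\<lambda>c f x. c * f x)\<rparr>"

definition tensor_comp ::
    "nat \<Rightarrow> nat \<Rightarrow> nat \<Rightarrow> (nat \<Rightarrow> real) \<Rightarrow> (nat \<Rightarrow> real) \<Rightarrow> nat \<Rightarrow> real" where
  "tensor_comp n k i x y p =
     (let \<eta> = (\<Sum>l = 1..k. y l) in
      if p < i then \<eta> * x p
      else if p < i + k then x i * y (p + 1 - i)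
      else \<eta> * x (p + 1 - k))"

definition partial_tensor_operad :: "(nat \<Rightarrow> real) operad" where
  "partial_tensor_operad =
     \<lparr>opspace = (\<lambda>n. function_space {1..n}),
      opact = (\<lambda>n \<sigma> x j. x (inv_into UNIV \<sigma> j)),
      opcomp = tensor_comp,
      opunit = (\<lambda>j. if j = 1 then 1 else 0)\<rparr>"


section \<open>The operad of cooperative games\<close>

text \<open>
  The player set of an \<open>n\<close>-ary game is \<open>{1..n}\<close>; in a composition at \<open>i\<close> the players
  are renumbered by \<open>outer_pos\<close> and \<open>inner_pos\<close>.
\<close>

definition marginal :: "nat \<Rightarrow> (nat set \<Rightarrow> real) \<Rightarrow> nat set \<Rightarrow> real" where
  "marginal i v T = v (T \<union> {i}) - v (T - {i})"

definition outer_part :: "nat \<Rightarrow> nat \<Rightarrow> nat \<Rightarrow> nat set \<Rightarrow> nat set" where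
  "outer_part n k i S = {j \<in> {1..n} - {i}. outer_pos i k j \<in> S}"

definition inner_part :: "nat \<Rightarrow> nat \<Rightarrow> nat set \<Rightarrow> nat set" where
  "inner_part k i S = {q \<in> {1..k}. inner_pos i q \<in> S}"

definition game_comp ::
    "nat \<Rightarrow> nat \<Rightarrow> nat \<Rightarrow> (nat set \<Rightarrow> real) \<Rightarrow> (nat set \<Rightarrow> real) \<Rightarrow> nat set \<Rightarrow> real" where
  "game_comp n k i v w S =
     (if S \<subseteq> {1..n + k - 1}
      then w {1..k} * v (outer_part n k i S)
           + marginal i v (outer_part n k i S) * w (inner_part k i S)
      else 0)"

definition game_operad :: "(nat set \<Rightarrow> real) operad" where
  "game_operad =
     \<lparr>opspace = (\<lambda>n. function_space (Pow {1..n} - {{}})),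
      opact = (\<lambda>n \<sigma> v S. v (inv_into UNIV \<sigma> ` S)),
      opcomp = game_comp,
      opunit = (\<lambda>S. if S = {1} then 1 else 0)\<rparr>"

definition additive_games :: "nat \<Rightarrow> (nat set \<Rightarrow> real) set" where
  "additive_games n = {v \<in> ops game_operad n. \<forall>S\<subseteq>{1..n}. v S = (\<Sum>j\<in>S. v {j})}"


section \<open>The permutative operad\<close>

text \<open>
  The free operad on one binary operation without symmetry has in arity \<open>n\<close> the basis of
  planar binary trees whose leaves are labelled bijectively by \<open>1, \<dots>, n\<close>. An element is
  its family of coefficients; permutations relabel the leaves, and the bilinear partial
  composition is grafting of trees.
\<close>

datatype 'a btree = Leaf 'a | Node "'a btree" "'a btree"

primrec leaves :: "'a btree \<Rightarrow> 'a list" where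
  "leaves (Leaf a) = [a]"
| "leaves (Node s t) = leaves s @ leaves t"

definition labelled_trees :: "nat \<Rightarrow> nat btree set" where
  "labelled_trees n = {t. distinct (leaves t) \<and> set (leaves t) = {1..n}}"

primrec graft :: "nat \<Rightarrow> nat \<Rightarrow> nat btree \<Rightarrow> nat btree \<Rightarrow> nat btree" where
  "graft i k (Leaf j) u =
     (if j = i then map_btree (inner_pos i) u else Leaf (outer_pos i k j))"
| "graft i k (Node s t) u = Node (graft i k s u) (graft i k t u)"

definition tree_vec :: "nat btree \<Rightarrow> nat btree \<Rightarrow> real" where
  "tree_vec t = (\<lambda>s. if s = t then 1 else 0)"

definition free_magmatic_operad :: "(nat btree \<Rightarrow> real) operad" where
  "free_magmatic_operad =
     \<lparr>opspace = (\<lambda>n. function_space (labelled_trees n)),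
      opact = (\<lambda>n \<sigma> f t. f (map_btree (inv_into UNIV \<sigma>) t)),
      opcomp = (\<lambda>n k i f g u. \<Sum>t\<in>labelled_trees n. \<Sum>s\<in>labelled_trees k.
        if graft i k t s = u then f t * g s else 0),
      opunit = tree_vec (Leaf 1)\<rparr>"

definition rho :: "nat btree \<Rightarrow> real" where
  "rho = tree_vec (Node (Leaf 1) (Leaf 2))"

definition perm_relators :: "nat \<Rightarrow> (nat btree \<Rightarrow> real) set" where
  "perm_relators n =
     (let comp = opcomp free_magmatic_operad 2 2;
          swap_rho = opact free_magmatic_operad 2 (transpose 1 2) rho;
          V = opspace free_magmatic_operad 3
      in if n = 3
         then {comp 1 rho rho \<ominus>\<^bsub>V\<^esub> comp 2 rho rho, comp 2 rho rho \<ominus>\<^bsub>V\<^esub> comp 2 rho swap_rho}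
         else {})"

definition perm_operad :: "(nat btree \<Rightarrow> real) set operad" where
  "perm_operad =
     quotient_operad free_magmatic_operad (generated_ideal free_magmatic_operad perm_relators)"

end

theory Submission
  imports Defs
begin

text \<open>
  An additive game is determined by its values on single players, and these values can be prescribed
  freely, so the additive games with \<open>n\<close> players form \<open>\<real>\<^sup>n\<close>. The marginal contribution of player \<open>i\<close>
  to an additive game \<open>v\<close> is the constant \<open>v {i}\<close>, and the value of the grand coalition of an additive
  game \<open>w\<close> is the sum \<open>\<eta>\<close> of its values on single players. Hence the composition formula for games,
  evaluated at a single player, gives \<open>\<eta> * v {j}\<close> at an old player \<open>j\<close> and \<open>v {i} * w {q}\<close> at a new
  player \<open>q\<close>: this is the partial tensor product (\<open>game_comp_additive\<close>,
  \<open>operad_iso_games_tensor\<close>). The axioms of an operad are verified for all games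
  (\<open>operad_game\<close>), pass to the suboperad of additive games, and are transported from there along
  isomorphisms (\<open>operad_transport\<close>).

  For the permutative operad, map a planar tree with labelled leaves to the basis vector of its
  leftmost label. The leftmost leaf of a graft of \<open>u\<close> into \<open>t\<close> at \<open>i\<close> is that of \<open>t\<close>, unless the latter is
  \<open>i\<close>, in which case it is that of \<open>u\<close>; partial tensor products of basis vectors obey the same rule. So
  the linear extension \<open>root_sums\<close> of this map is a surjective morphism onto the partial tensor
  operad (\<open>root_sums_comp\<close>, \<open>root_sums_surj\<close>), and it remains to identify its kernel with the ideal
  generated by the permutative relations.

  The three trees in these relations have the leftmost leaf \<open>1\<close>, so the generated ideal lies in the
  kernel. For the converse, the relations allow one to reassociate a tree and to exchange the
  two halves of a right branch. Reassociation turns any tree into a left comb with the same leftmost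
  leaf, and both moves together permute the remaining leaves of a comb arbitrarily. So two trees with
  the same labels and the same leftmost leaf are congruent modulo the relations
  (\<open>perm_equivI\<close>, \<open>same_root_diff\<close>). The differences of such pairs span the kernel
  (\<open>kernel_subset_ideal\<close>). The isomorphism theorem for operads (\<open>operad_iso_quotient\<close>) then identifies
  the permutative operad with the partial tensor operad.
\<close>

section \<open>Linear maps between real vector spaces\<close>

lemma linear_mapI:
  assumes "\<And>x. x \<in> carrier V \<Longrightarrow> f x \<in> carrier W"
    and "\<And>x y. \<lbrakk>x \<in> carrier V; y \<in> carrier V\<rbrakk> \<Longrightarrow> f (x \<oplus>\<^bsub>V\<^esub> y) = f x \<oplus>\<^bsub>W\<^esub> f y"
    and "\<And>c x. x \<in> carrier V \<Longrightarrow> f (c \<odot>\<^bsub>V\<^esub> x) = c \<odot>\<^bsub>W\<^esub> f x"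
  shows "linear_map V W f"
  using assms unfolding linear_map_def by auto

lemma linear_mapD:
  assumes "linear_map V W f"
  shows "x \<in> carrier V \<Longrightarrow> f x \<in> carrier W"
    and "\<lbrakk>x \<in> carrier V; y \<in> carrier V\<rbrakk> \<Longrightarrow> f (x \<oplus>\<^bsub>V\<^esub> y) = f x \<oplus>\<^bsub>W\<^esub> f y"
    and "x \<in> carrier V \<Longrightarrow> f (c \<odot>\<^bsub>V\<^esub> x) = c \<odot>\<^bsub>W\<^esub> f x"
  using assms unfolding linear_map_def by auto

lemma real_field_simps [simp]:
  "carrier real_field = UNIV" "\<one>\<^bsub>real_field\<^esub> = 1" "\<zero>\<^bsub>real_field\<^esub> = 0"
  "a \<oplus>\<^bsub>real_field\<^esub> b = a + b" "a \<otimes>\<^bsub>real_field\<^esub> b = a * b"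
  by (simp_all add: ring_of_type_algebra_def)

lemma real_module_simps:
  assumes "module real_field V"
  shows "\<lbrakk>x \<in> carrier V; y \<in> carrier V\<rbrakk> \<Longrightarrow> x \<oplus>\<^bsub>V\<^esub> y \<in> carrier V"
    and "\<zero>\<^bsub>V\<^esub> \<in> carrier V"
    and "x \<in> carrier V \<Longrightarrow> c \<odot>\<^bsub>V\<^esub> x \<in> carrier V"
    and "\<lbrakk>x \<in> carrier V; y \<in> carrier V; z \<in> carrier V\<rbrakk> \<Longrightarrow> (x \<oplus>\<^bsub>V\<^esub> y) \<oplus>\<^bsub>V\<^esub> z = x \<oplus>\<^bsub>V\<^esub> (y \<oplus>\<^bsub>V\<^esub> z)"
    and "\<lbrakk>x \<in> carrier V; y \<in> carrier V\<rbrakk> \<Longrightarrow> x \<oplus>\<^bsub>V\<^esub> y = y \<oplus>\<^bsub>V\<^esub> x"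
    and "x \<in> carrier V \<Longrightarrow> \<zero>\<^bsub>V\<^esub> \<oplus>\<^bsub>V\<^esub> x = x"
    and "x \<in> carrier V \<Longrightarrow> (a + b) \<odot>\<^bsub>V\<^esub> x = a \<odot>\<^bsub>V\<^esub> x \<oplus>\<^bsub>V\<^esub> b \<odot>\<^bsub>V\<^esub> x"
    and "\<lbrakk>x \<in> carrier V; y \<in> carrier V\<rbrakk> \<Longrightarrow> a \<odot>\<^bsub>V\<^esub> (x \<oplus>\<^bsub>V\<^esub> y) = a \<odot>\<^bsub>V\<^esub> x \<oplus>\<^bsub>V\<^esub> a \<odot>\<^bsub>V\<^esub> y"
    and "x \<in> carrier V \<Longrightarrow> (a * b) \<odot>\<^bsub>V\<^esub> x = a \<odot>\<^bsub>V\<^esub> (b \<odot>\<^bsub>V\<^esub> x)"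
    and "x \<in> carrier V \<Longrightarrow> 1 \<odot>\<^bsub>V\<^esub> x = x"
    and "x \<in> carrier V \<Longrightarrow> 0 \<odot>\<^bsub>V\<^esub> x = \<zero>\<^bsub>V\<^esub>"
proof -
  interpret module real_field V by fact
  show "\<lbrakk>x \<in> carrier V; y \<in> carrier V\<rbrakk> \<Longrightarrow> x \<oplus>\<^bsub>V\<^esub> y \<in> carrier V"
    and "\<zero>\<^bsub>V\<^esub> \<in> carrier V"
    and "x \<in> carrier V \<Longrightarrow> c \<odot>\<^bsub>V\<^esub> x \<in> carrier V"
    and "\<lbrakk>x \<in> carrier V; y \<in> carrier V; z \<in> carrier V\<rbrakk> \<Longrightarrow> (x \<oplus>\<^bsub>V\<^esub> y) \<oplus>\<^bsub>V\<^esub> z = x \<oplus>\<^bsub>V\<^esub> (y \<oplus>\<^bsub>V\<^esub> z)"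
    and "\<lbrakk>x \<in> carrier V; y \<in> carrier V\<rbrakk> \<Longrightarrow> x \<oplus>\<^bsub>V\<^esub> y = y \<oplus>\<^bsub>V\<^esub> x"
    and "x \<in> carrier V \<Longrightarrow> \<zero>\<^bsub>V\<^esub> \<oplus>\<^bsub>V\<^esub> x = x"
    using M.a_ac by (simp_all add: M.a_assoc)
  show "x \<in> carrier V \<Longrightarrow> (a + b) \<odot>\<^bsub>V\<^esub> x = a \<odot>\<^bsub>V\<^esub> x \<oplus>\<^bsub>V\<^esub> b \<odot>\<^bsub>V\<^esub> x"
    and "\<lbrakk>x \<in> carrier V; y \<in> carrier V\<rbrakk> \<Longrightarrow> a \<odot>\<^bsub>V\<^esub> (x \<oplus>\<^bsub>V\<^esub> y) = a \<odot>\<^bsub>V\<^esub> x \<oplus>\<^bsub>V\<^esub> a \<odot>\<^bsub>V\<^esub> y"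
    and "x \<in> carrier V \<Longrightarrow> (a * b) \<odot>\<^bsub>V\<^esub> x = a \<odot>\<^bsub>V\<^esub> (b \<odot>\<^bsub>V\<^esub> x)"
    and "x \<in> carrier V \<Longrightarrow> 1 \<odot>\<^bsub>V\<^esub> x = x"
    and "x \<in> carrier V \<Longrightarrow> 0 \<odot>\<^bsub>V\<^esub> x = \<zero>\<^bsub>V\<^esub>"
    using smult_l_distr[of a b x] smult_r_distr[of a x y] smult_assoc1[of a b x]
      smult_one[of x] smult_l_null[of x] by simp_all
qed

lemma real_module_neg:
  assumes "module real_field V" "x \<in> carrier V"
  shows "(-1) \<odot>\<^bsub>V\<^esub> x \<oplus>\<^bsub>V\<^esub> x = \<zero>\<^bsub>V\<^esub>"
  using real_module_simps(7)[OF assms, of "-1" 1] real_module_simps(10,11)[OF assms] by simp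

lemma real_moduleI:
  assumes "\<And>x y. \<lbrakk>x \<in> carrier V; y \<in> carrier V\<rbrakk> \<Longrightarrow> x \<oplus>\<^bsub>V\<^esub> y \<in> carrier V"
    and "\<zero>\<^bsub>V\<^esub> \<in> carrier V"
    and "\<And>c x. x \<in> carrier V \<Longrightarrow> c \<odot>\<^bsub>V\<^esub> x \<in> carrier V"
    and "\<And>x y z. \<lbrakk>x \<in> carrier V; y \<in> carrier V; z \<in> carrier V\<rbrakk>
           \<Longrightarrow> (x \<oplus>\<^bsub>V\<^esub> y) \<oplus>\<^bsub>V\<^esub> z = x \<oplus>\<^bsub>V\<^esub> (y \<oplus>\<^bsub>V\<^esub> z)"
    and "\<And>x y. \<lbrakk>x \<in> carrier V; y \<in> carrier V\<rbrakk> \<Longrightarrow> x \<oplus>\<^bsub>V\<^esub> y = y \<oplus>\<^bsub>V\<^esub> x"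
    and "\<And>x. x \<in> carrier V \<Longrightarrow> \<zero>\<^bsub>V\<^esub> \<oplus>\<^bsub>V\<^esub> x = x"
    and "\<And>x. x \<in> carrier V \<Longrightarrow> (-1) \<odot>\<^bsub>V\<^esub> x \<oplus>\<^bsub>V\<^esub> x = \<zero>\<^bsub>V\<^esub>"
    and "\<And>a b x. x \<in> carrier V \<Longrightarrow> (a + b) \<odot>\<^bsub>V\<^esub> x = a \<odot>\<^bsub>V\<^esub> x \<oplus>\<^bsub>V\<^esub> b \<odot>\<^bsub>V\<^esub> x"
    and "\<And>a x y. \<lbrakk>x \<in> carrier V; y \<in> carrier V\<rbrakk> \<Longrightarrow> a \<odot>\<^bsub>V\<^esub> (x \<oplus>\<^bsub>V\<^esub> y) = a \<odot>\<^bsub>V\<^esub> x \<oplus>\<^bsub>V\<^esub> a \<odot>\<^bsub>V\<^esub> y"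
    and "\<And>a b x. x \<in> carrier V \<Longrightarrow> (a * b) \<odot>\<^bsub>V\<^esub> x = a \<odot>\<^bsub>V\<^esub> (b \<odot>\<^bsub>V\<^esub> x)"
    and "\<And>x. x \<in> carrier V \<Longrightarrow> 1 \<odot>\<^bsub>V\<^esub> x = x"
  shows "module real_field V"
proof (rule moduleI)
  show "cring real_field" by (rule cring_from_type_algebra)
  show "abelian_group V"
  proof (rule abelian_groupI)
    fix x assume "x \<in> carrier V"
    then show "\<exists>y\<in>carrier V. y \<oplus>\<^bsub>V\<^esub> x = \<zero>\<^bsub>V\<^esub>" using assms(3,7) by blast
  qed (fact assms)+
qed (use assms in simp_all)

text \<open>
  Closure under negation comes from multiplication by \<open>-1\<close>.
\<close>

lemma submodule_iff:
  assumes V: "module real_field V"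
  shows "submodule H real_field V \<longleftrightarrow> H \<subseteq> carrier V \<and> \<zero>\<^bsub>V\<^esub> \<in> H \<and>
    (\<forall>x\<in>H. \<forall>y\<in>H. x \<oplus>\<^bsub>V\<^esub> y \<in> H) \<and> (\<forall>c. \<forall>x\<in>H. c \<odot>\<^bsub>V\<^esub> x \<in> H)"
proof
  interpret module real_field V by fact
  assume H: "submodule H real_field V"
  then interpret H: submodule H real_field V .
  show "H \<subseteq> carrier V \<and> \<zero>\<^bsub>V\<^esub> \<in> H \<and>
    (\<forall>x\<in>H. \<forall>y\<in>H. x \<oplus>\<^bsub>V\<^esub> y \<in> H) \<and> (\<forall>c. \<forall>x\<in>H. c \<odot>\<^bsub>V\<^esub> x \<in> H)"
    using H.subset H.one_closed H.m_closed H.smult_closed by auto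
next
  interpret module real_field V by fact
  assume H: "H \<subseteq> carrier V \<and> \<zero>\<^bsub>V\<^esub> \<in> H \<and>
    (\<forall>x\<in>H. \<forall>y\<in>H. x \<oplus>\<^bsub>V\<^esub> y \<in> H) \<and> (\<forall>c. \<forall>x\<in>H. c \<odot>\<^bsub>V\<^esub> x \<in> H)"
  show "submodule H real_field V"
  proof (rule submoduleI)
    fix a assume a: "a \<in> H"
    then have "\<ominus>\<^bsub>V\<^esub> a = (-1) \<odot>\<^bsub>V\<^esub> a"
      using H real_module_neg[OF V, of a] real_module_simps(3)[OF V]
      by (intro M.minus_equality) auto
    then show "\<ominus>\<^bsub>V\<^esub> a \<in> H" using H a by simp
  qed (use H in auto)
qed

lemma function_space_simps [simp]:
  "f \<in> carrier (function_space A) \<longleftrightarrow> (\<forall>x. x \<notin> A \<longrightarrow> f x = 0)"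
  "\<zero>\<^bsub>function_space A\<^esub> = (\<lambda>x. 0)"
  "f \<oplus>\<^bsub>function_space A\<^esub> g = (\<lambda>x. f x + g x)"
  "c \<odot>\<^bsub>function_space A\<^esub> f = (\<lambda>x. c * f x)"
  by (simp_all add: function_space_def)

lemma module_function_space: "module real_field (function_space A)"
  by (rule real_moduleI) (auto simp: algebra_simps)

lemma function_space_minus:
  assumes "f \<in> carrier (function_space A)" "g \<in> carrier (function_space A)"
  shows "f \<ominus>\<^bsub>function_space A\<^esub> g = (\<lambda>x. f x - g x)"
proof -
  interpret module real_field "function_space A" by (rule module_function_space)
  have "\<ominus>\<^bsub>function_space A\<^esub> g = (\<lambda>x. - g x)"
    using assms by (intro M.minus_equality) auto
  then show ?thesis by (simp add: a_minus_def)
qed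

text \<open>
  The zero of the target is an independent component of its record, so additivity of \<open>f\<close> alone does
  not force it to be \<open>f \<zero>\<close>; this is the purpose of the last hypothesis.
\<close>

lemma module_transport:
  assumes V: "module real_field V" and lin: "linear_map V W f"
    and bij: "bij_betw f (carrier V) (carrier W)" and zero: "f \<zero>\<^bsub>V\<^esub> = \<zero>\<^bsub>W\<^esub>"
  shows "module real_field W"
proof -
  note V' = real_module_simps[OF V] real_module_neg[OF V]
  note f = linear_mapD(2,3)[OF lin, symmetric] zero[symmetric]
  have W: "carrier W = f ` carrier V" using bij by (simp add: bij_betw_def)
  show ?thesis
  proof (rule real_moduleI; (unfold W, (elim imageE)?))
    fix x y z x' y' z'
    assume "x' \<in> carrier V" "y' \<in> carrier V" "z' \<in> carrier V" "x = f x'" "y = f y'" "z = f z'"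
    then show "(x \<oplus>\<^bsub>W\<^esub> y) \<oplus>\<^bsub>W\<^esub> z = x \<oplus>\<^bsub>W\<^esub> (y \<oplus>\<^bsub>W\<^esub> z)"
      by (simp add: f V'(1,4))
  next
    fix x y x' y'
    assume "x' \<in> carrier V" "y' \<in> carrier V" "x = f x'" "y = f y'"
    then show "x \<oplus>\<^bsub>W\<^esub> y = y \<oplus>\<^bsub>W\<^esub> x"
      using V'(5)[of x' y'] by (simp add: f)
  qed (simp_all add: f V'(1-3,6-12))
qed

lemma linear_map_transport:
  assumes V: "module real_field V" and f: "linear_map V V' f" "bij_betw f (carrier V) (carrier V')"
    and h: "linear_map W W' h" and g: "linear_map V W g"
    and comm: "\<And>x. x \<in> carrier V \<Longrightarrow> g' (f x) = h (g x)"
  shows "linear_map V' W' g'"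
proof -
  have V': "carrier V' = f ` carrier V" using f(2) by (simp add: bij_betw_def)
  note fs = linear_mapD(2,3)[OF f(1), symmetric]
  note hs = linear_mapD[OF h] and gs = linear_mapD[OF g]
  show ?thesis
    by (rule linear_mapI; unfold V'; elim imageE)
      (simp_all add: fs hs gs comm real_module_simps(1,3)[OF V])
qed

section \<open>Positions of inputs in a partial composition\<close>

lemma outer_pos_bounds:
  assumes "j \<in> {1..n} - {i}" "i \<in> {1..n}"
  shows "outer_pos i k j \<in> {1..n + k - 1}" "outer_pos i k j \<notin> {i..<i + k}"
  using assms by (auto simp: outer_pos_def)

lemma inner_pos_bounds:
  assumes "q \<in> {1..k}" "i \<in> {1..n}"
  shows "inner_pos i q \<in> {1..n + k - 1}" "inner_pos i q \<in> {i..<i + k}"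
  using assms by (auto simp: inner_pos_def)

text \<open>
  The inputs of a composite are the old inputs other than \<open>i\<close> and the inserted ones. Together with the
  bounds above, which put the inserted inputs exactly into \<open>{i..<i + k}\<close>, this makes the composite a
  disjoint union.
\<close>

lemma pos_cases:
  assumes "p \<in> {1..n + k - 1}" "i \<in> {1..n}"
  obtains j where "j \<in> {1..n} - {i}" "p = outer_pos i k j"
  | q where "q \<in> {1..k}" "p = inner_pos i q"
proof -
  consider "p < i" | "p \<in> {i..<i + k}" | "i + k \<le> p" using assms by force
  then show thesis
  proof cases
    case 1 with assms that(1)[of p] show ?thesis by (auto simp: outer_pos_def)
  next
    case 2
    then have "p + 1 - i \<in> {1..k}" "p = inner_pos i (p + 1 - i)"
      using assms by (auto simp: inner_pos_def)
    then show ?thesis by (rule that(2))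
  next
    case 3
    then have "p + 1 - k \<in> {1..n} - {i}" "p = outer_pos i k (p + 1 - k)"
      using assms by (auto simp: outer_pos_def)
    then show ?thesis by (rule that(1))
  qed
qed

lemma perm_comp_outer:
  assumes "j \<in> {1..n} - {i}" "i \<in> {1..n}"
  shows "perm_comp n k i \<sigma> \<tau> (outer_pos i k j) = outer_pos (\<sigma> i) k (\<sigma> j)"
  using assms by (auto simp: perm_comp_def outer_pos_def)

lemma perm_comp_inner:
  assumes "q \<in> {1..k}" "i \<in> {1..n}"
  shows "perm_comp n k i \<sigma> \<tau> (inner_pos i q) = inner_pos (\<sigma> i) (\<tau> q)"
  using assms by (auto simp: perm_comp_def inner_pos_def)

text \<open>
  A surjection of a finite set onto itself is a bijection, so it is enough to hit each input of the
  composite; a preimage comes from the inverses of \<open>\<sigma>\<close> and \<open>\<tau>\<close>.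
\<close>

lemma perm_comp_permutes:
  assumes i: "i \<in> {1..n}" and \<sigma>: "\<sigma> permutes {1..n}" and \<tau>: "\<tau> permutes {1..k}"
  shows "perm_comp n k i \<sigma> \<tau> permutes {1..n + k - 1}"
proof (rule bij_imp_permutes)
  let ?N = "{1..n + k - 1}" and ?\<pi> = "perm_comp n k i \<sigma> \<tau>"
  have \<sigma>i: "\<sigma> i \<in> {1..n}" using permutes_in_image[OF \<sigma>] i by blast
  have into: "?\<pi> ` ?N \<subseteq> ?N"
  proof (intro image_subsetI)
    fix p assume "p \<in> ?N"
    then show "?\<pi> p \<in> ?N" using i
    proof (cases rule: pos_cases)
      case (1 j)
      then have "\<sigma> j \<in> {1..n} - {\<sigma> i}"
        using permutes_in_image[OF \<sigma>] permutes_inj[OF \<sigma>] by (auto dest: injD)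
      then show ?thesis using 1 i perm_comp_outer outer_pos_bounds(1) \<sigma>i by metis
    next
      case (2 q)
      then show ?thesis
        using i perm_comp_inner inner_pos_bounds(1) \<sigma>i permutes_in_image[OF \<tau>] by metis
    qed
  qed
  have "p \<in> ?\<pi> ` ?N" if p: "p \<in> ?N" for p
    using p \<sigma>i
  proof (cases rule: pos_cases)
    case (1 j)
    then have "inv_into UNIV \<sigma> j \<in> {1..n} - {i}" "\<sigma> (inv_into UNIV \<sigma> j) = j"
      using permutes_in_image[OF permutes_inv[OF \<sigma>]] permutes_inverses[OF \<sigma>] by auto
    then show ?thesis
      using 1 i perm_comp_outer[of "inv_into UNIV \<sigma> j" n i k \<sigma> \<tau>] outer_pos_bounds(1) by (metis imageI)
  next
    case (2 q)
    then have "inv_into UNIV \<tau> q \<in> {1..k}" "\<tau> (inv_into UNIV \<tau> q) = q"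
      using permutes_in_image[OF permutes_inv[OF \<tau>]] permutes_inverses[OF \<tau>] by metis+
    then show ?thesis
      using 2 i perm_comp_inner[of "inv_into UNIV \<tau> q" k i n \<sigma> \<tau>] inner_pos_bounds(1) by (metis imageI)
  qed
  with into have "?\<pi> ` ?N = ?N" by blast
  then show "bij_betw ?\<pi> ?N ?N"
    by (simp add: bij_betw_def eq_card_imp_inj_on)
qed (simp add: perm_comp_def)

section \<open>Isomorphisms, transport and suboperads\<close>

context operad
begin

lemma act_closed:
  "\<lbrakk>n \<ge> 1; \<sigma> permutes {1..n}; x \<in> ops P n\<rbrakk> \<Longrightarrow> opact P n \<sigma> x \<in> ops P n"
  using act_linear linear_mapD(1) by metis

lemma comp_closed:
  "\<lbrakk>n \<ge> 1; k \<ge> 1; i \<in> {1..n}; x \<in> ops P n; y \<in> ops P k\<rbrakk>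
   \<Longrightarrow> opcomp P n k i x y \<in> ops P (n + k - 1)"
  using comp_linear_left[of n k i y] linear_mapD(1) by metis

end

lemma operad_isoD:
  assumes "operad_iso P Q \<phi>" "n \<ge> 1"
  shows "linear_map (opspace P n) (opspace Q n) (\<phi> n)"
    and "bij_betw (\<phi> n) (ops P n) (ops Q n)"
    and "\<lbrakk>\<sigma> permutes {1..n}; x \<in> ops P n\<rbrakk> \<Longrightarrow> \<phi> n (opact P n \<sigma> x) = opact Q n \<sigma> (\<phi> n x)"
    and "\<lbrakk>k \<ge> 1; i \<in> {1..n}; x \<in> ops P n; y \<in> ops P k\<rbrakk> \<Longrightarrow>
      \<phi> (n + k - 1) (opcomp P n k i x y) = opcomp Q n k i (\<phi> n x) (\<phi> k y)"
    and "\<phi> 1 (opunit P) = opunit Q"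
  using assms unfolding operad_iso_def by blast+

text \<open>
  Each compatibility of the inverse holds after applying \<open>\<phi>\<close>. Cancelling \<open>\<phi>\<close> requires the elements
  involved to lie in \<open>P\<close>, which is where the axioms of \<open>P\<close> enter.
\<close>

lemma operad_iso_inverse:
  assumes "operad P" and iso: "operad_iso P Q \<phi>"
  shows "operad_iso Q P (\<lambda>n. inv_into (ops P n) (\<phi> n))"
proof -
  interpret operad P by fact
  let ?\<psi> = "\<lambda>n. inv_into (ops P n) (\<phi> n)"
  note lin = operad_isoD(1)[OF iso] and bij = operad_isoD(2)[OF iso]
  have \<psi>\<phi>: "?\<psi> n (\<phi> n x) = x" if "n \<ge> 1" "x \<in> ops P n" for n x
    using bij[OF that(1)] that(2) by (simp add: bij_betw_inv_into_left)
  have clo: "?\<psi> n y \<in> ops P n" if "n \<ge> 1" "y \<in> ops Q n" for n y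
    using that bij[of n] by (metis bij_betw_def inv_into_into)
  have \<phi>\<psi>: "\<phi> n (?\<psi> n y) = y" if "n \<ge> 1" "y \<in> ops Q n" for n y
    using bij[OF that(1)] that(2) by (simp add: bij_betw_inv_into_right)
  note sp = real_module_simps(1,3)[OF vector_space]
  show ?thesis
    unfolding operad_iso_def
  proof (intro conjI allI impI ballI)
    fix n :: nat assume n: "1 \<le> n"
    show "bij_betw (?\<psi> n) (ops Q n) (ops P n)" using bij[OF n] by (rule bij_betw_inv_into)
    show "linear_map (opspace Q n) (opspace P n) (?\<psi> n)"
    proof (rule linear_mapI)
      fix x y c assume x: "x \<in> ops Q n"
      show "?\<psi> n x \<in> ops P n" using clo n x by simp
      have "\<phi> n (c \<odot>\<^bsub>opspace P n\<^esub> ?\<psi> n x) = c \<odot>\<^bsub>opspace Q n\<^esub> x"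
        using linear_mapD(3)[OF lin[OF n]] clo \<phi>\<psi> n x by simp
      then show "?\<psi> n (c \<odot>\<^bsub>opspace Q n\<^esub> x) = c \<odot>\<^bsub>opspace P n\<^esub> ?\<psi> n x"
        using \<psi>\<phi>[OF n] sp(2)[OF n] clo n x by metis
      assume y: "y \<in> ops Q n"
      have "\<phi> n (?\<psi> n x \<oplus>\<^bsub>opspace P n\<^esub> ?\<psi> n y) = x \<oplus>\<^bsub>opspace Q n\<^esub> y"
        using linear_mapD(2)[OF lin[OF n]] clo \<phi>\<psi> n x y by simp
      then show "?\<psi> n (x \<oplus>\<^bsub>opspace Q n\<^esub> y) = ?\<psi> n x \<oplus>\<^bsub>opspace P n\<^esub> ?\<psi> n y"
        using \<psi>\<phi>[OF n] sp(1)[OF n] clo n x y by metis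
    qed
  next
    fix n :: nat and \<sigma> x assume *: "1 \<le> n" "\<sigma> permutes {1..n}" "x \<in> ops Q n"
    have "\<phi> n (opact P n \<sigma> (?\<psi> n x)) = opact Q n \<sigma> x"
      using operad_isoD(3)[OF iso] * clo \<phi>\<psi> by simp
    then show "?\<psi> n (opact Q n \<sigma> x) = opact P n \<sigma> (?\<psi> n x)"
      using \<psi>\<phi> act_closed clo * by metis
  next
    fix n k :: nat and i x y
    assume *: "1 \<le> n" "1 \<le> k" "i \<in> {1..n}" "x \<in> ops Q n" "y \<in> ops Q k"
    have N: "1 \<le> n + k - 1" using *(1,2) by simp
    have "\<phi> (n + k - 1) (opcomp P n k i (?\<psi> n x) (?\<psi> k y)) = opcomp Q n k i x y"
      using operad_isoD(4)[OF iso] * clo \<phi>\<psi> by simp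
    then show "?\<psi> (n + k - 1) (opcomp Q n k i x y) = opcomp P n k i (?\<psi> n x) (?\<psi> k y)"
      using \<psi>\<phi>[OF N] comp_closed clo * by metis
  next
    show "?\<psi> 1 (opunit Q) = opunit P"
      using \<psi>\<phi>[OF order_refl unit_closed] operad_isoD(5)[OF iso order_refl] by metis
  qed
qed

lemma operad_iso_compose:
  assumes \<phi>: "operad_iso P Q \<phi>" and \<psi>: "operad_iso Q R \<psi>"
  shows "operad_iso P R (\<lambda>n. \<psi> n \<circ> \<phi> n)"
proof -
  have clo: "\<phi> n x \<in> ops Q n" if "n \<ge> 1" "x \<in> ops P n" for n x
    using operad_isoD(1)[OF \<phi> that(1)] that(2) by (rule linear_mapD)
  show ?thesis
    unfolding operad_iso_def
  proof (intro conjI allI impI ballI)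
    fix n :: nat assume n: "1 \<le> n"
    show "bij_betw (\<psi> n \<circ> \<phi> n) (ops P n) (ops R n)"
      using operad_isoD(2)[OF \<phi> n] operad_isoD(2)[OF \<psi> n] by (rule bij_betw_trans)
    show "linear_map (opspace P n) (opspace R n) (\<psi> n \<circ> \<phi> n)"
      by (rule linear_mapI) (simp_all add: linear_mapD[OF operad_isoD(1)[OF \<phi> n]]
        linear_mapD[OF operad_isoD(1)[OF \<psi> n]])
  next
    fix n :: nat and \<sigma> x assume *: "1 \<le> n" "\<sigma> permutes {1..n}" "x \<in> ops P n"
    then show "(\<psi> n \<circ> \<phi> n) (opact P n \<sigma> x) = opact R n \<sigma> ((\<psi> n \<circ> \<phi> n) x)"
      using clo by (simp add: operad_isoD(3)[OF \<phi>] operad_isoD(3)[OF \<psi>])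
  next
    fix n k :: nat and i x y
    assume *: "1 \<le> n" "1 \<le> k" "i \<in> {1..n}" "x \<in> ops P n" "y \<in> ops P k"
    then show "(\<psi> (n + k - 1) \<circ> \<phi> (n + k - 1)) (opcomp P n k i x y)
      = opcomp R n k i ((\<psi> n \<circ> \<phi> n) x) ((\<psi> k \<circ> \<phi> k) y)"
      using clo operad_isoD(4)[OF \<phi>, of n k i x y] operad_isoD(4)[OF \<psi>, of n k i "\<phi> n x" "\<phi> k y"]
      by simp
  next
    show "(\<psi> 1 \<circ> \<phi> 1) (opunit P) = opunit R"
      using operad_isoD(5)[OF \<phi>, of 1] operad_isoD(5)[OF \<psi>, of 1] by simp
  qed
qed

text \<open>
  Every element of \<open>Q\<close> is an image under \<open>\<phi>\<close>, and every axiom for such images is the image of the same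
  axiom in \<open>P\<close>. This spares a direct verification for the partial tensor operad, and for the quotient
  that defines the permutative operad it avoids computing with cosets.
\<close>

lemma operad_transport:
  assumes "operad P" and iso: "operad_iso P Q \<phi>"
    and zero: "\<And>n. n \<ge> 1 \<Longrightarrow> \<phi> n \<zero>\<^bsub>opspace P n\<^esub> = \<zero>\<^bsub>opspace Q n\<^esub>"
  shows "operad Q"
proof -
  interpret operad P by fact
  note lin = operad_isoD(1)[OF iso] and bij = operad_isoD(2)[OF iso]
  note clo = linear_mapD(1)[OF lin] 
  have surj: "\<And>n. n \<ge> 1 \<Longrightarrow> ops Q n = \<phi> n ` ops P n" using bij by (simp add: bij_betw_def)
  note act = operad_isoD(3)[OF iso, symmetric] and comp = operad_isoD(4)[OF iso, symmetric]
  have unit: "opunit Q = \<phi> 1 (opunit P)" using operad_isoD(5)[OF iso, of 1] by simp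
  have N: "1 \<le> n + k - 1" if "1 \<le> n" "1 \<le> k" for n k :: nat using that by simp
  show ?thesis
  proof (rule operad.intro, goal_cases)
  \<comment> \<open>the cases in order: spaces (1), action (2--4), bilinearity (5, 6), unit (7--9),
    sequential (10) and parallel (11) associativity, equivariance (12)\<close>
    case (1 n)
    then show ?case using module_transport[OF vector_space lin bij zero] by simp
  next
    case (2 n \<sigma>)
    show ?case
      by (rule linear_map_transport[OF vector_space lin bij lin act_linear]) (use 2 in \<open>simp_all add: act\<close>)
  next
    case (3 n x)
    then show ?case by (auto simp: surj act[OF _ permutes_id] act_id)
  next
    case (4 n \<sigma> \<tau> x)
    then show ?case by (auto simp: surj act act_closed permutes_compose act_comp)
  next
    case (5 n k i y)
    then obtain y' where "y' \<in> ops P k" "y = \<phi> k y'" by (auto simp: surj)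
    then show ?case
      by (intro linear_map_transport[OF vector_space lin bij lin comp_linear_left])
        (use 5 N[of n k] in \<open>simp_all only: comp\<close>)
  next
    case (6 n k i x)
    then obtain x' where "x' \<in> ops P n" "x = \<phi> n x'" by (auto simp: surj)
    then show ?case
      by (intro linear_map_transport[OF vector_space lin bij lin comp_linear_right])
        (use 6 N[of n k] in \<open>simp_all only: comp\<close>)
  next
    case 7
    show ?case unfolding unit using clo[of 1] unit_closed by simp
  next
    case (8 n x)
    then obtain x' where x': "x' \<in> ops P n" "x = \<phi> n x'" by (auto simp: surj)
    have "opcomp Q 1 n 1 (opunit Q) x = \<phi> (1 + n - 1) (opcomp P 1 n 1 (opunit P) x')"
      unfolding unit x'(2) using 8 x'(1) unit_closed by (intro comp) auto
    then show ?case using unit_left[OF 8(1) x'(1)] x'(2) by simp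
  next
    case (9 n i x)
    then obtain x' where x': "x' \<in> ops P n" "x = \<phi> n x'" by (auto simp: surj)
    have "opcomp Q n 1 i x (opunit Q) = \<phi> (n + 1 - 1) (opcomp P n 1 i x' (opunit P))"
      unfolding unit x'(2) using 9 x'(1) unit_closed by (intro comp) auto
    then show ?case using unit_right[OF 9(1,2) x'(1)] x'(2) by simp
  next
    case (10 n k m i j x y z)
    then obtain x' y' z' where *: "x' \<in> ops P n" "y' \<in> ops P k" "z' \<in> ops P m"
      and eq: "x = \<phi> n x'" "y = \<phi> k y'" "z = \<phi> m z'"
      unfolding surj[OF 10(1)] surj[OF 10(2)] surj[OF 10(3)] by blast
    note n = 10(1-5) and N = N[OF 10(1,2)] N[OF 10(2,3)]
    have ij: "inner_pos i j \<in> {1..n + k - 1}" using inner_pos_bounds(1)[OF n(5,4)] .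
    have assoc: "n + k - 1 + m - 1 = n + (k + m - 1) - 1" using n by simp
    have "opcomp Q (n + k - 1) m (inner_pos i j) (opcomp Q n k i x y) z
      = \<phi> (n + k - 1 + m - 1) (opcomp P (n + k - 1) m (inner_pos i j) (opcomp P n k i x' y') z')"
      unfolding eq comp[OF n(1,2,4) *(1,2)]
      by (rule comp[OF N(1) n(3) ij comp_closed[OF n(1,2,4) *(1,2)] *(3)])
    also have "\<dots> = \<phi> (n + (k + m - 1) - 1) (opcomp P n (k + m - 1) i x' (opcomp P k m j y' z'))"
      unfolding assoc comp_sequential[OF n *] ..
    also have "\<dots> = opcomp Q n (k + m - 1) i x (opcomp Q k m j y z)"
      unfolding eq comp[OF n(2,3,5) *(2,3)]
      by (rule comp[symmetric, OF n(1) N(2) n(4) *(1) comp_closed[OF n(2,3,5) *(2,3)]])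
    finally show ?case .
  next
    case (11 n k m i l x y z)
    then obtain x' y' z' where *: "x' \<in> ops P n" "y' \<in> ops P k" "z' \<in> ops P m"
      and eq: "x = \<phi> n x'" "y = \<phi> k y'" "z = \<phi> m z'"
      unfolding surj[OF 11(1)] surj[OF 11(2)] surj[OF 11(3)] by blast
    note n = 11(1-6) and N = N[OF 11(1,2)] N[OF 11(1,3)]
    have il: "outer_pos i k l \<in> {1..n + k - 1}" "i \<in> {1..n + m - 1}"
      using n outer_pos_bounds(1)[of l n i k] by auto
    have assoc: "n + k - 1 + m - 1 = n + m - 1 + k - 1" using n by simp
    have "opcomp Q (n + k - 1) m (outer_pos i k l) (opcomp Q n k i x y) z
      = \<phi> (n + k - 1 + m - 1) (opcomp P (n + k - 1) m (outer_pos i k l) (opcomp P n k i x' y') z')"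
      unfolding eq comp[OF n(1,2,4) *(1,2)]
      by (rule comp[OF N(1) n(3) il(1) comp_closed[OF n(1,2,4) *(1,2)] *(3)])
    also have "\<dots> = \<phi> (n + m - 1 + k - 1) (opcomp P (n + m - 1) k i (opcomp P n m l x' z') y')"
      unfolding assoc comp_parallel[OF n *] ..
    also have "\<dots> = opcomp Q (n + m - 1) k i (opcomp Q n m l x z) y"
      unfolding eq comp[OF n(1,3,5) *(1,3)]
      by (rule comp[symmetric, OF N(2) n(2) il(2) comp_closed[OF n(1,3,5) *(1,3)] *(2)])
    finally show ?case .
  next
    case (12 n k i \<sigma> \<tau> x y)
    then obtain x' y' where *: "x' \<in> ops P n" "y' \<in> ops P k"
      and eq: "x = \<phi> n x'" "y = \<phi> k y'"
      unfolding surj[OF 12(1)] surj[OF 12(2)] by blast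
    note n = 12(1-5) and N = N[OF 12(1,2)]
    have \<sigma>i: "\<sigma> i \<in> {1..n}" using n permutes_in_image by metis
    have "opcomp Q n k (\<sigma> i) (opact Q n \<sigma> x) (opact Q k \<tau> y)
      = \<phi> (n + k - 1) (opcomp P n k (\<sigma> i) (opact P n \<sigma> x') (opact P k \<tau> y'))"
      unfolding eq act[OF n(1,4) *(1)] act[OF n(2,5) *(2)]
      by (rule comp[OF n(1,2) \<sigma>i act_closed[OF n(1,4) *(1)] act_closed[OF n(2,5) *(2)]])
    also have "\<dots> = opact Q (n + k - 1) (perm_comp n k i \<sigma> \<tau>) (opcomp Q n k i x y)"
      unfolding comp_equivariant[OF n *] eq comp[OF n(1-3) *]
      by (rule act[symmetric, OF N perm_comp_permutes[OF n(3-5)] comp_closed[OF n(1-3) *]])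
    finally show ?case .
  qed
qed

lemma restrict_operad_simps [simp]:
  "ops (restrict_operad P H) n = H n"
  "x \<oplus>\<^bsub>opspace (restrict_operad P H) n\<^esub> y = x \<oplus>\<^bsub>opspace P n\<^esub> y"
  "c \<odot>\<^bsub>opspace (restrict_operad P H) n\<^esub> x = c \<odot>\<^bsub>opspace P n\<^esub> x"
  "\<zero>\<^bsub>opspace (restrict_operad P H) n\<^esub> = \<zero>\<^bsub>opspace P n\<^esub>"
  "opact (restrict_operad P H) = opact P"
  "opcomp (restrict_operad P H) = opcomp P"
  "opunit (restrict_operad P H) = opunit P"
  by (simp_all add: restrict_operad_def)

lemma linear_map_restrict:
  assumes "linear_map V W f" "H \<subseteq> carrier V" "\<And>x. x \<in> H \<Longrightarrow> f x \<in> K"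
  shows "linear_map (V\<lparr>carrier := H\<rparr>) (W\<lparr>carrier := K\<rparr>) f"
  using assms unfolding linear_map_def by (auto simp: subset_iff)

lemma operad_restrict:
  assumes "suboperad P H"
  shows "operad (restrict_operad P H)"
proof -
  interpret operad P using assms by (simp add: suboperad_def)
  have sub: "\<And>n. n \<ge> 1 \<Longrightarrow> submodule (H n) real_field (opspace P n)"
    and act: "\<And>n \<sigma> x. \<lbrakk>n \<ge> 1; \<sigma> permutes {1..n}; x \<in> H n\<rbrakk> \<Longrightarrow> opact P n \<sigma> x \<in> H n"
    and comp: "\<And>n k i x y. \<lbrakk>n \<ge> 1; k \<ge> 1; i \<in> {1..n}; x \<in> H n; y \<in> H k\<rbrakk>
      \<Longrightarrow> opcomp P n k i x y \<in> H (n + k - 1)"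
    and unit: "opunit P \<in> H 1"
    using assms by (simp_all add: suboperad_def)
  have subset: "H n \<subseteq> ops P n" if "n \<ge> 1" for n
    using sub[OF that] submodule_iff[OF vector_space[OF that]] by simp
  have mem: "x \<in> ops P n" if "n \<ge> 1" "x \<in> H n" for n x
    using subset that by blast
  have sp: "opspace (restrict_operad P H) n = (opspace P n)\<lparr>carrier := H n\<rparr>" for n
    by (simp add: restrict_operad_def)
  show ?thesis
  proof (rule operad.intro, goal_cases)
  \<comment> \<open>the cases in order: spaces (1), action (2--4), bilinearity (5, 6), unit (7--9),
    sequential (10) and parallel (11) associativity, equivariance (12)\<close>
    case (1 n)
    then show ?case
      unfolding sp by (intro submodule.submodule_is_module[OF sub] vector_space)
  next
    case (2 n \<sigma>)
    then show ?case
      unfolding sp by (auto intro!: linear_map_restrict act_linear subset act)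
  next
    case (5 n k i y)
    then show ?case
      unfolding sp restrict_operad_simps
      by (intro linear_map_restrict comp_linear_left subset comp mem) auto
  next
    case (6 n k i x)
    then show ?case
      unfolding sp restrict_operad_simps
      by (intro linear_map_restrict comp_linear_right subset comp mem) auto
  next
    case 10
    then show ?case
      unfolding restrict_operad_simps by (intro comp_sequential mem) auto
  next
    case 11
    then show ?case
      unfolding restrict_operad_simps by (intro comp_parallel mem) auto
  next
    case 12
    then show ?case
      unfolding restrict_operad_simps by (intro comp_equivariant mem) auto
  next
    case 8
    then show ?case
      unfolding restrict_operad_simps by (intro unit_left mem) auto
  next
    case 9
    then show ?case
      unfolding restrict_operad_simps by (intro unit_right mem) auto
  qed (use unit in \<open>simp_all add: mem act_id act_comp\<close>)
qed

section \<open>Quotients by the kernel of an epimorphism\<close>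

lemma linear_map_zero:
  assumes "module real_field V" "module real_field W" "linear_map V W f"
  shows "f \<zero>\<^bsub>V\<^esub> = \<zero>\<^bsub>W\<^esub>"
  using linear_mapD(3)[OF assms(3) real_module_simps(2)[OF assms(1)], of 0]
    linear_mapD(1)[OF assms(3) real_module_simps(2)[OF assms(1)]]
    real_module_simps(2,11)[OF assms(1)] real_module_simps(11)[OF assms(2)] by simp

text \<open>
  The source \<open>F\<close> is thought of as an operad of trees. Of its operations only closure is assumed: the
  axioms of an operad for the quotient come from the target.
\<close>

locale operad_epimorphism = operad Q for Q :: "'b operad" +
  fixes F :: "'a operad" and \<psi> :: "nat \<Rightarrow> 'a \<Rightarrow> 'b"
  assumes source_space: "n \<ge> 1 \<Longrightarrow> module real_field (opspace F n)"
    and source_act: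
      "\<lbrakk>n \<ge> 1; \<sigma> permutes {1..n}; x \<in> ops F n\<rbrakk> \<Longrightarrow> opact F n \<sigma> x \<in> ops F n"
    and source_comp:
      "\<lbrakk>n \<ge> 1; k \<ge> 1; i \<in> {1..n}; x \<in> ops F n; y \<in> ops F k\<rbrakk> \<Longrightarrow>
       opcomp F n k i x y \<in> ops F (n + k - 1)"
    and source_unit: "opunit F \<in> ops F 1"
    and map_linear: "n \<ge> 1 \<Longrightarrow> linear_map (opspace F n) (opspace Q n) (\<psi> n)"
    and map_surj: "n \<ge> 1 \<Longrightarrow> \<psi> n ` ops F n = ops Q n"
    and map_act:
      "\<lbrakk>n \<ge> 1; \<sigma> permutes {1..n}; x \<in> ops F n\<rbrakk> \<Longrightarrow> \<psi> n (opact F n \<sigma> x) = opact Q n \<sigma> (\<psi> n x)"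
    and map_comp:
      "\<lbrakk>n \<ge> 1; k \<ge> 1; i \<in> {1..n}; x \<in> ops F n; y \<in> ops F k\<rbrakk> \<Longrightarrow>
       \<psi> (n + k - 1) (opcomp F n k i x y) = opcomp Q n k i (\<psi> n x) (\<psi> k y)"
    and map_unit: "\<psi> 1 (opunit F) = opunit Q"
begin

definition fibre :: "nat \<Rightarrow> 'b \<Rightarrow> 'a set" where
  "fibre n q = {x \<in> ops F n. \<psi> n x = q}"

abbreviation kern :: "nat \<Rightarrow> 'a set" where
  "kern n \<equiv> fibre n \<zero>\<^bsub>opspace Q n\<^esub>"

lemma kern_submodule:
  assumes "n \<ge> 1"
  shows "submodule (kern n) real_field (opspace F n)"
  using real_module_simps[OF source_space[OF assms]] real_module_simps[OF vector_space[OF assms]]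
    linear_mapD[OF map_linear[OF assms]]
    linear_map_zero[OF source_space vector_space map_linear, OF assms assms assms]
    module.smult_r_null[OF vector_space[OF assms]]
  by (auto simp: submodule_iff[OF source_space[OF assms]] fibre_def)

lemma operad_ideal_kern: "operad_ideal F kern"
  unfolding operad_ideal_def
proof (intro conjI allI impI ballI)
  fix n :: nat assume "1 \<le> n"
  then show "submodule (kern n) real_field (opspace F n)" by (rule kern_submodule)
next
  fix n \<sigma> x assume *: "1 \<le> n" "\<sigma> permutes {1..n}" "x \<in> kern n"
  then have "opact Q n \<sigma> \<zero>\<^bsub>opspace Q n\<^esub> = \<zero>\<^bsub>opspace Q n\<^esub>"
    by (intro linear_map_zero vector_space act_linear)
  then show "opact F n \<sigma> x \<in> kern n"
    using * source_act map_act by (auto simp: fibre_def)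
next
  fix n k :: nat and i x y
  assume *: "1 \<le> n" "1 \<le> k" "i \<in> {1..n}" "x \<in> kern n" "y \<in> ops F k"
  then have "\<psi> k y \<in> ops Q k" using map_surj by blast
  then have "opcomp Q n k i \<zero>\<^bsub>opspace Q n\<^esub> (\<psi> k y) = \<zero>\<^bsub>opspace Q (n + k - 1)\<^esub>"
    using * linear_map_zero[OF vector_space vector_space comp_linear_left] by auto
  then show "opcomp F n k i x y \<in> kern (n + k - 1)"
    using * source_comp map_comp by (auto simp: fibre_def)
next
  fix n k :: nat and i x y
  assume *: "1 \<le> n" "1 \<le> k" "i \<in> {1..n}" "x \<in> ops F n" "y \<in> kern k"
  then have "\<psi> n x \<in> ops Q n" using map_surj by blast
  then have "opcomp Q n k i (\<psi> n x) \<zero>\<^bsub>opspace Q k\<^esub> = \<zero>\<^bsub>opspace Q (n + k - 1)\<^esub>"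
    using * linear_map_zero[OF vector_space vector_space comp_linear_right] by auto
  then show "opcomp F n k i x y \<in> kern (n + k - 1)"
    using * source_comp map_comp by (auto simp: fibre_def)
qed

lemma fibre_nonempty:
  assumes "n \<ge> 1" "q \<in> ops Q n"
  obtains x where "x \<in> fibre n q"
proof -
  from assms(2) obtain x where "x \<in> ops F n" "q = \<psi> n x"
    unfolding map_surj[OF assms(1), symmetric] by (rule imageE)
  then have "x \<in> fibre n q" by (simp add: fibre_def)
  then show thesis by (rule that)
qed

text \<open>
  The operations of the quotient are unions over representatives. In terms of the map \<open>\<psi>\<close>, cosets of
  the kernel are its fibres, and such a union collapses because \<open>\<psi>\<close> is constant on them.
\<close>

lemma coset_eq_fibre:
  assumes n: "n \<ge> 1" and a: "a \<in> ops F n"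
  shows "kern n +>\<^bsub>opspace F n\<^esub> a = fibre n (\<psi> n a)"
proof
  note F = real_module_simps[OF source_space[OF n]] and Q = real_module_simps[OF vector_space[OF n]]
  note lin = linear_mapD[OF map_linear[OF n]]
  show "kern n +>\<^bsub>opspace F n\<^esub> a \<subseteq> fibre n (\<psi> n a)"
    using a F(1) Q(6) lin by (auto simp: a_r_coset_def' fibre_def)
  show "fibre n (\<psi> n a) \<subseteq> kern n +>\<^bsub>opspace F n\<^esub> a"
  proof
    fix x assume "x \<in> fibre n (\<psi> n a)"
    then have x: "x \<in> ops F n" "\<psi> n x = \<psi> n a" by (auto simp: fibre_def)
    \<comment> \<open>the element \<open>x - a\<close> of the kernel\<close>
    let ?h = "(-1) \<odot>\<^bsub>opspace F n\<^esub> a \<oplus>\<^bsub>opspace F n\<^esub> x"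
    have "?h \<in> kern n"
      using a x F(1,3) lin real_module_neg[OF vector_space[OF n]] by (simp add: fibre_def)
    moreover have "?h \<oplus>\<^bsub>opspace F n\<^esub> a = x"
      using a x F(1,3,4,6) F(5)[of x a] F(4)[of "(-1) \<odot>\<^bsub>opspace F n\<^esub> a" a x]
        real_module_neg[OF source_space[OF n] a] by simp
    ultimately show "x \<in> kern n +>\<^bsub>opspace F n\<^esub> a"
      unfolding a_r_coset_def' by force
  qed
qed

lemma set_add_fibre:
  assumes n: "n \<ge> 1" and q: "q \<in> ops Q n" "r \<in> ops Q n"
  shows "fibre n q <+>\<^bsub>opspace F n\<^esub> fibre n r = fibre n (q \<oplus>\<^bsub>opspace Q n\<^esub> r)"
proof
  note F = real_module_simps[OF source_space[OF n]] and Q = real_module_simps[OF vector_space[OF n]]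
  note lin = linear_mapD[OF map_linear[OF n]]
  show "fibre n q <+>\<^bsub>opspace F n\<^esub> fibre n r \<subseteq> fibre n (q \<oplus>\<^bsub>opspace Q n\<^esub> r)"
    using F(1) lin by (auto simp: set_add_def' fibre_def)
  show "fibre n (q \<oplus>\<^bsub>opspace Q n\<^esub> r) \<subseteq> fibre n q <+>\<^bsub>opspace F n\<^esub> fibre n r"
  proof
    fix z assume "z \<in> fibre n (q \<oplus>\<^bsub>opspace Q n\<^esub> r)"
    then have z: "z \<in> ops F n" "\<psi> n z = q \<oplus>\<^bsub>opspace Q n\<^esub> r" by (auto simp: fibre_def)
    obtain a where "a \<in> fibre n q" using fibre_nonempty[OF n q(1)] .
    then have a: "a \<in> ops F n" "\<psi> n a = q" by (auto simp: fibre_def)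
    let ?m = "(-1) \<odot>\<^bsub>opspace F n\<^esub> a"
    let ?b = "?m \<oplus>\<^bsub>opspace F n\<^esub> z"
    have "?b \<in> fibre n r"
      using a z F(1,3) lin real_module_neg[OF vector_space[OF n] q(1)] Q(6)[OF q(2)]
        Q(4)[OF Q(3)[OF q(1)] q, of "-1"] by (simp add: fibre_def)
    moreover have "a \<oplus>\<^bsub>opspace F n\<^esub> ?b = z"
      using a z F(3,6) F(5)[of a ?m] F(4)[of a ?m z] real_module_neg[OF source_space[OF n] a(1)]
      by simp
    ultimately show "z \<in> fibre n q <+>\<^bsub>opspace F n\<^esub> fibre n r"
      using a by (force simp: set_add_def' fibre_def)
  qed
qed

lemma fibre_UN:
  assumes "n \<ge> 1" "q \<in> ops Q n" "\<And>x. \<lbrakk>x \<in> ops F n; \<psi> n x = q\<rbrakk> \<Longrightarrow> G x = R"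
  shows "(\<Union>x\<in>fibre n q. G x) = R"
proof -
  have "(\<Union>x\<in>fibre n q. G x) = (\<Union>x\<in>fibre n q. R)"
    by (rule SUP_cong) (simp_all add: fibre_def assms(3))
  moreover have "fibre n q \<noteq> {}" using fibre_nonempty[OF assms(1,2)] by blast
  ultimately show ?thesis by simp
qed

lemma fibre_inj:
  assumes "n \<ge> 1"
  shows "inj_on (fibre n) (ops Q n)"
proof (rule inj_onI)
  fix q r assume *: "q \<in> ops Q n" "fibre n q = fibre n r"
  obtain x where "x \<in> fibre n q" using fibre_nonempty[OF assms *(1)] .
  moreover from this have "x \<in> fibre n r" unfolding *(2) .
  ultimately show "q = r" by (simp add: fibre_def)
qed

text \<open>
  This is the first isomorphism theorem for operads, stated from the image to the quotient: an element
  of \<open>Q\<close> goes to its fibre.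
\<close>

theorem operad_iso_quotient:
  assumes I: "\<And>n. n \<ge> 1 \<Longrightarrow> I n = kern n"
  shows "operad_iso Q (quotient_operad F I) fibre"
  unfolding operad_iso_def
proof (intro conjI allI impI ballI)
  fix n :: nat assume n: "1 \<le> n"
  have "ops (quotient_operad F I) n = (\<lambda>a. kern n +>\<^bsub>opspace F n\<^esub> a) ` ops F n"
    by (auto simp: quotient_operad_def I[OF n] A_RCOSETS_def')
  also have "\<dots> = fibre n ` \<psi> n ` ops F n"
    unfolding image_image using coset_eq_fibre[OF n] by (rule image_cong[OF refl])
  finally have carrier: "ops (quotient_operad F I) n = fibre n ` ops Q n"
    using map_surj[OF n] by simp
  then show "bij_betw (fibre n) (ops Q n) (ops (quotient_operad F I) n)"
    using fibre_inj[OF n] by (simp add: bij_betw_def)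
  show "linear_map (opspace Q n) (opspace (quotient_operad F I) n) (fibre n)"
  proof (rule linear_mapI)
    fix q r c assume q: "q \<in> ops Q n"
    show "fibre n q \<in> ops (quotient_operad F I) n" using carrier q by simp
    have "(\<Union>a\<in>fibre n q. kern n +>\<^bsub>opspace F n\<^esub> (c \<odot>\<^bsub>opspace F n\<^esub> a)) = fibre n (c \<odot>\<^bsub>opspace Q n\<^esub> q)"
      using n q coset_eq_fibre real_module_simps(3)[OF source_space] linear_mapD(3)[OF map_linear]
      by (intro fibre_UN) auto
    then show "fibre n (c \<odot>\<^bsub>opspace Q n\<^esub> q) = c \<odot>\<^bsub>opspace (quotient_operad F I) n\<^esub> fibre n q"
      by (simp add: quotient_operad_def I[OF n])
    assume r: "r \<in> ops Q n"
    show "fibre n (q \<oplus>\<^bsub>opspace Q n\<^esub> r) = fibre n q \<oplus>\<^bsub>opspace (quotient_operad F I) n\<^esub> fibre n r"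
      using set_add_fibre[OF n q r] by (simp add: quotient_operad_def)
  qed
next
  fix n \<sigma> q assume *: "1 \<le> n" "\<sigma> permutes {1..n}" "q \<in> ops Q n"
  have "(\<Union>a\<in>fibre n q. kern n +>\<^bsub>opspace F n\<^esub> opact F n \<sigma> a) = fibre n (opact Q n \<sigma> q)"
    using * coset_eq_fibre source_act map_act by (intro fibre_UN) auto
  then show "fibre n (opact Q n \<sigma> q) = opact (quotient_operad F I) n \<sigma> (fibre n q)"
    by (simp add: quotient_operad_def I[OF *(1)])
next
  fix n k :: nat and i q r
  assume *: "1 \<le> n" "1 \<le> k" "i \<in> {1..n}" "q \<in> ops Q n" "r \<in> ops Q k"
  then have N: "1 \<le> n + k - 1" by auto
  have "(\<Union>a\<in>fibre n q. \<Union>b\<in>fibre k r. kern (n + k - 1) +>\<^bsub>opspace F (n + k - 1)\<^esub> opcomp F n k i a b)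
    = fibre (n + k - 1) (opcomp Q n k i q r)"
    by (intro fibre_UN *)
      (simp only: coset_eq_fibre[OF N source_comp[OF *(1-3)]] map_comp[OF *(1-3)])
  then show "fibre (n + k - 1) (opcomp Q n k i q r)
    = opcomp (quotient_operad F I) n k i (fibre n q) (fibre k r)"
    by (simp add: quotient_operad_def I[OF N, simplified])
next
  show "fibre 1 (opunit Q) = opunit (quotient_operad F I)"
    using coset_eq_fibre[OF order_refl source_unit] map_unit
    by (simp add: quotient_operad_def I)
qed

lemma operad_quotient:
  assumes "\<And>n. n \<ge> 1 \<Longrightarrow> I n = kern n"
  shows "operad (quotient_operad F I)"
  by (rule operad_transport[OF operad_axioms operad_iso_quotient[OF assms]])
    (simp_all add: quotient_operad_def assms)

end

section \<open>The operad of games\<close>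

lemma game_operad_simps [simp]:
  "opspace game_operad n = function_space (Pow {1..n} - {{}})"
  "opcomp game_operad = game_comp"
  "opunit game_operad = (\<lambda>S. if S = {1} then 1 else 0)"
  by (simp_all add: game_operad_def)

text \<open>
  As a preimage, the permuted coalition commutes with the set operations in the composition formula without
  appeal to injectivity.
\<close>

lemma game_act:
  assumes "\<sigma> permutes A"
  shows "opact game_operad n \<sigma> v = (\<lambda>S. v (\<sigma> -` S))"
  using bij_vimage_eq_inv_image[OF permutes_bij[OF assms]] by (simp add: game_operad_def)

lemma permutes_vimage_subset_iff:
  assumes "\<sigma> permutes A"
  shows "\<sigma> -` S \<subseteq> A \<longleftrightarrow> S \<subseteq> A"
  using permutes_in_image[OF assms] permutes_surj[OF assms] by (metis permutes_vimage[OF assms] surj_image_vimage_eq image_mono vimage_mono permutes_image[OF assms])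

lemma game_act_closed:
  assumes "\<sigma> permutes {1..n}" "v \<in> ops game_operad n"
  shows "opact game_operad n \<sigma> v \<in> ops game_operad n"
proof -
  have "\<sigma> -` S = {} \<longleftrightarrow> S = {}" for S
    using permutes_surj[OF assms(1)] by (metis surj_image_vimage_eq image_empty vimage_empty)
  then show ?thesis
    using assms(2) permutes_vimage_subset_iff[OF assms(1)] by (simp add: game_act[OF assms(1)])
qed

lemma outer_part_subset: "outer_part n k i S \<subseteq> {1..n} - {i}"
  by (auto simp: outer_part_def)

lemma inner_part_subset: "inner_part k i S \<subseteq> {1..k}"
  by (auto simp: inner_part_def)

lemma parts_empty [simp]: "outer_part n k i {} = {}" "inner_part k i {} = {}"
  by (auto simp: outer_part_def inner_part_def)

lemma parts_full:
  assumes "i \<in> {1..n}"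
  shows "outer_part n k i {1..n + k - 1} = {1..n} - {i}" "inner_part k i {1..n + k - 1} = {1..k}"
  using assms outer_pos_bounds(1)[of _ n i k] inner_pos_bounds(1)[of _ k i n]
  unfolding outer_part_def inner_part_def by blast+

text \<open>
  A marginal contribution of an inserted player leaves the old part of a coalition alone; below, one of
  an old player leaves the inserted part alone. These facts compute the marginals of a composite game.
\<close>

lemma parts_update_inner:
  assumes "j \<in> {1..k}"
  shows "outer_part n k i (insert (inner_pos i j) S) = outer_part n k i S"
    and "outer_part n k i (S - {inner_pos i j}) = outer_part n k i S"
    and "inner_part k i (insert (inner_pos i j) S) = insert j (inner_part k i S)"
    and "inner_part k i (S - {inner_pos i j}) = inner_part k i S - {j}"
  using assms by (auto simp: outer_part_def inner_part_def outer_pos_def inner_pos_def)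

lemma parts_update_outer:
  assumes "j \<in> {1..n} - {i}"
  shows "outer_part n k i (insert (outer_pos i k j) S) = insert j (outer_part n k i S)"
    and "outer_part n k i (S - {outer_pos i k j}) = outer_part n k i S - {j}"
    and "inner_part k i (insert (outer_pos i k j) S) = inner_part k i S"
    and "inner_part k i (S - {outer_pos i k j}) = inner_part k i S"
  using assms
  by (auto simp: outer_part_def inner_part_def outer_pos_def inner_pos_def split: if_splits)

text \<open>
  Both sides of the sequential axiom split a coalition into the same three parts: the players of the
  outer, the middle and the innermost game.
\<close>

lemma parts_sequential:
  assumes "i \<in> {1..n}" "j \<in> {1..k}" "m \<ge> 1"
  shows "outer_part n k i (outer_part (n + k - 1) m (inner_pos i j) S) = outer_part n (k + m - 1) i S"
    and "inner_part k i (outer_part (n + k - 1) m (inner_pos i j) S) =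
         outer_part k m j (inner_part (k + m - 1) i S)"
    and "inner_part m (inner_pos i j) S = inner_part m j (inner_part (k + m - 1) i S)"
proof -
  have pos: "outer_pos (inner_pos i j) m (outer_pos i k q) = outer_pos i (k + m - 1) q"
    if "q \<noteq> i" for q
    using assms that by (auto simp: outer_pos_def inner_pos_def)
  have pos': "outer_pos (inner_pos i j) m (inner_pos i q) = inner_pos i (outer_pos j m q)"
    if "q \<noteq> j" "q \<ge> 1" for q
    using assms that by (auto simp: outer_pos_def inner_pos_def)
  have iff: "inner_pos i q = inner_pos i j \<longleftrightarrow> q = j" if "q \<ge> 1" for q
    using assms that by (auto simp: inner_pos_def)
  have ne: "outer_pos i k q \<noteq> inner_pos i j" if "q \<in> {1..n} - {i}" for q
    using assms that by (auto simp: outer_pos_def inner_pos_def)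
  show "outer_part n k i (outer_part (n + k - 1) m (inner_pos i j) S) = outer_part n (k + m - 1) i S"
    using assms outer_pos_bounds(1)[of _ n i k] ne unfolding outer_part_def by (auto simp: pos)
  show "inner_part k i (outer_part (n + k - 1) m (inner_pos i j) S) =
    outer_part k m j (inner_part (k + m - 1) i S)"
  proof (rule Set.set_eqI)
    fix q
    show "q \<in> inner_part k i (outer_part (n + k - 1) m (inner_pos i j) S) \<longleftrightarrow>
      q \<in> outer_part k m j (inner_part (k + m - 1) i S)"
    proof (cases "q \<in> {1..k} - {j}")
      case True
      then have "inner_pos i q \<in> {1..n + k - 1}" "outer_pos j m q \<in> {1..k + m - 1}"
        "inner_pos i q \<noteq> inner_pos i j"
        "outer_pos (inner_pos i j) m (inner_pos i q) = inner_pos i (outer_pos j m q)"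
        using inner_pos_bounds(1)[OF _ assms(1), of q k] outer_pos_bounds(1)[OF True assms(2), of m]
          iff pos' by auto
      then show ?thesis using True unfolding outer_part_def inner_part_def by simp
    qed (auto simp: outer_part_def inner_part_def)
  qed
  show "inner_part m (inner_pos i j) S = inner_part m j (inner_part (k + m - 1) i S)"
  proof (rule Set.set_eqI)
    fix q
    show "q \<in> inner_part m (inner_pos i j) S \<longleftrightarrow> q \<in> inner_part m j (inner_part (k + m - 1) i S)"
    proof (cases "q \<in> {1..m}")
      case True
      then have "inner_pos j q \<in> {1..k + m - 1}" "inner_pos (inner_pos i j) q = inner_pos i (inner_pos j q)"
        using inner_pos_bounds(1)[OF True assms(2)] assms by (auto simp: inner_pos_def)
      then show ?thesis using True unfolding inner_part_def by simp
    qed (auto simp: inner_part_def)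
  qed
qed

text \<open>
  Both sides of the parallel axiom split a coalition into the same three parts. The numbering is
  asymmetric: since \<open>i < l\<close>, inserting at \<open>l\<close> does not move \<open>i\<close>, whereas inserting at \<open>i\<close> moves \<open>l\<close>.
\<close>

lemma parts_parallel:
  assumes "i \<in> {1..n}" "l \<in> {1..n}" "i < l" "k \<ge> 1" "m \<ge> 1"
  shows "outer_part n k i (outer_part (n + k - 1) m (outer_pos i k l) S) =
         outer_part n m l (outer_part (n + m - 1) k i S)"
    and "inner_part k i (outer_part (n + k - 1) m (outer_pos i k l) S) = inner_part k i S"
    and "inner_part m l (outer_part (n + m - 1) k i S) = inner_part m (outer_pos i k l) S"
proof -
  let ?p = "outer_pos i k l"
  show "outer_part n k i (outer_part (n + k - 1) m ?p S) = outer_part n m l (outer_part (n + m - 1) k i S)"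
  proof (rule Set.set_eqI)
    fix j
    show "j \<in> outer_part n k i (outer_part (n + k - 1) m ?p S) \<longleftrightarrow>
      j \<in> outer_part n m l (outer_part (n + m - 1) k i S)"
    proof (cases "j \<in> {1..n} - {i} - {l}")
      case True
      then have "outer_pos i k j \<in> {1..n + k - 1} - {?p}" "outer_pos l m j \<in> {1..n + m - 1} - {i}"
        "outer_pos ?p m (outer_pos i k j) = outer_pos i k (outer_pos l m j)"
        using assms by (auto simp: outer_pos_def)
      then show ?thesis using True unfolding outer_part_def by simp
    qed (use assms in \<open>auto simp: outer_part_def outer_pos_def\<close>)
  qed
  show "inner_part k i (outer_part (n + k - 1) m ?p S) = inner_part k i S"
  proof (rule Set.set_eqI)
    fix q
    show "q \<in> inner_part k i (outer_part (n + k - 1) m ?p S) \<longleftrightarrow> q \<in> inner_part k i S"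
    proof (cases "q \<in> {1..k}")
      case True
      then have "inner_pos i q \<in> {1..n + k - 1} - {?p}" "outer_pos ?p m (inner_pos i q) = inner_pos i q"
        using assms by (auto simp: outer_pos_def inner_pos_def)
      then show ?thesis using True unfolding outer_part_def inner_part_def by simp
    qed (auto simp: inner_part_def)
  qed
  show "inner_part m l (outer_part (n + m - 1) k i S) = inner_part m ?p S"
  proof (rule Set.set_eqI)
    fix q
    show "q \<in> inner_part m l (outer_part (n + m - 1) k i S) \<longleftrightarrow> q \<in> inner_part m ?p S"
    proof (cases "q \<in> {1..m}")
      case True
      then have "inner_pos l q \<in> {1..n + m - 1} - {i}" "outer_pos i k (inner_pos l q) = inner_pos ?p q"
        using assms by (auto simp: outer_pos_def inner_pos_def)
      then show ?thesis using True unfolding outer_part_def inner_part_def by simp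
    qed (auto simp: inner_part_def)
  qed
qed

lemma game_comp_closed:
  assumes "v \<in> ops game_operad n" "w \<in> ops game_operad k"
  shows "game_comp n k i v w \<in> ops game_operad (n + k - 1)"
  using assms by (auto simp: game_comp_def)

text \<open>
  With \<open>S\<close> everything, the formula telescopes: the term \<open>w(B) v(A - {i})\<close> cancels the subtracted part of
  the marginal.
\<close>

lemma game_comp_full:
  assumes "i \<in> {1..n}"
  shows "game_comp n k i v w {1..n + k - 1} = v {1..n} * w {1..k}"
  unfolding game_comp_def marginal_def parts_full[OF assms]
  using assms by (simp add: insert_absorb algebra_simps)

lemma game_comp_equivariant:
  assumes i: "i \<in> {1..n}" and \<sigma>: "\<sigma> permutes {1..n}" and \<tau>: "\<tau> permutes {1..k}"
  shows "game_comp n k (\<sigma> i) (\<lambda>S. v (\<sigma> -` S)) (\<lambda>S. w (\<tau> -` S)) S =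
         game_comp n k i v w (perm_comp n k i \<sigma> \<tau> -` S)"
proof -
  let ?\<pi> = "perm_comp n k i \<sigma> \<tau>"
  have \<sigma>_eq: "\<sigma> j = \<sigma> i \<longleftrightarrow> j = i" for j
    using permutes_inj[OF \<sigma>] by (auto dest: injD)
  have outer: "\<sigma> -` outer_part n k (\<sigma> i) S = outer_part n k i (?\<pi> -` S)"
    by (simp only: set_eq_iff outer_part_def vimage_eq mem_Collect_eq Diff_iff singleton_iff
      permutes_in_image[OF \<sigma>] \<sigma>_eq perm_comp_outer[OF _ i] simp_thms cong: conj_cong)
  have inner: "\<tau> -` inner_part k (\<sigma> i) S = inner_part k i (?\<pi> -` S)"
    by (simp only: set_eq_iff inner_part_def vimage_eq mem_Collect_eq
      permutes_in_image[OF \<tau>] perm_comp_inner[OF _ i] simp_thms cong: conj_cong)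
  have upd: "\<sigma> -` (T \<union> {\<sigma> i}) = \<sigma> -` T \<union> {i}" "\<sigma> -` (T - {\<sigma> i}) = \<sigma> -` T - {i}" for T
    using \<sigma>_eq by auto
  show ?thesis
    unfolding game_comp_def marginal_def upd outer inner permutes_vimage[OF \<tau>]
      permutes_vimage_subset_iff[OF perm_comp_permutes[OF i \<sigma> \<tau>]] ..
qed

text \<open>
  The marginal of the composite \<open>x \<circ>\<^sub>i y\<close> at an inserted player \<open>j\<close> is the product of the marginal of \<open>x\<close> at
  \<open>i\<close> and that of \<open>y\<close> at \<open>j\<close>. With this and multiplicativity on the grand coalition, both sides are
  the same polynomial in the values on the three parts.
\<close>

lemma game_comp_sequential:
  assumes "m \<ge> 1" "i \<in> {1..n}" "j \<in> {1..k}"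
  shows "game_comp (n + k - 1) m (inner_pos i j) (game_comp n k i x y) z =
         game_comp n (k + m - 1) i x (game_comp k m j y z)"
proof
  fix S
  let ?O = "outer_part (n + k - 1) m (inner_pos i j) S"
  have "inner_pos i j \<in> {1..n + k - 1}" using inner_pos_bounds(1)[OF assms(3,2)] .
  then have sub: "?O \<subseteq> {1..n + k - 1}" "insert (inner_pos i j) ?O \<subseteq> {1..n + k - 1}"
    "?O - {inner_pos i j} \<subseteq> {1..n + k - 1}"
    using outer_part_subset[of "n + k - 1" m "inner_pos i j" S] by blast+
  have inn: "inner_part (k + m - 1) i S \<subseteq> {1..k + m - 1}" by (rule inner_part_subset)
  have N: "n + k - 1 + m - 1 = n + (k + m - 1) - 1" using assms by simp
  show "game_comp (n + k - 1) m (inner_pos i j) (game_comp n k i x y) z S =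
        game_comp n (k + m - 1) i x (game_comp k m j y z) S"
    unfolding game_comp_def[of "n + k - 1" m] game_comp_def[of n "k + m - 1"]
      game_comp_full[OF assms(3)] N
    unfolding game_comp_def marginal_def Un_insert_right Un_empty_right
    unfolding parts_update_inner[OF assms(3)] parts_sequential[OF assms(2,3,1)]
    using sub inn by (simp only: if_True) (simp add: algebra_simps)
qed

text \<open>
  Expanding both sides gives the same expression, because the second differences of \<open>x\<close> at \<open>i\<close> and \<open>l\<close> do
  not depend on the order in which the two players are added or removed.
\<close>

lemma game_comp_parallel:
  assumes "n \<ge> 1" "k \<ge> 1" "m \<ge> 1" "i \<in> {1..n}" "l \<in> {1..n}" "i < l"
  shows "game_comp (n + k - 1) m (outer_pos i k l) (game_comp n k i x y) z =
         game_comp (n + m - 1) k i (game_comp n m l x z) y"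
proof
  fix S
  let ?p = "outer_pos i k l"
  let ?O = "outer_part (n + k - 1) m ?p S" and ?O' = "outer_part (n + m - 1) k i S"
  have i: "outer_pos l m i = i" using assms by (simp add: outer_pos_def)
  have "?p \<in> {1..n + k - 1}" "i \<in> {1..n + m - 1}"
    using outer_pos_bounds(1)[of l n i k] assms by auto
  then have sub: "?O \<subseteq> {1..n + k - 1}" "insert ?p ?O \<subseteq> {1..n + k - 1}"
    "?O - {?p} \<subseteq> {1..n + k - 1}" "?O' \<subseteq> {1..n + m - 1}" "insert i ?O' \<subseteq> {1..n + m - 1}"
    "?O' - {i} \<subseteq> {1..n + m - 1}"
    using outer_part_subset[of "n + k - 1" m ?p S] outer_part_subset[of "n + m - 1" k i S] by blast+
  have upd: "l \<in> {1..n} - {i}" "i \<in> {1..n} - {l}" "i \<noteq> l" "l \<noteq> i" using assms by auto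
  have N: "n + k - 1 + m - 1 = n + m - 1 + k - 1" using assms by simp
  have nl: "l \<notin> outer_part n m l ?O'" and ni: "i \<notin> outer_part n m l ?O'"
    using i outer_part_subset[of "n + m - 1" k i S] by (auto simp: outer_part_def)
  show "game_comp (n + k - 1) m ?p (game_comp n k i x y) z S =
        game_comp (n + m - 1) k i (game_comp n m l x z) y S"
    unfolding game_comp_def[of "n + k - 1" m] game_comp_def[of "n + m - 1" k] N
    unfolding game_comp_def marginal_def Un_insert_right Un_empty_right
    unfolding parts_update_outer[OF upd(1), of k] parts_update_outer[OF upd(2), of m, unfolded i]
      parts_parallel[OF assms(4,5,6,2,3)]
    using sub upd ni nl
    by (simp only: if_True) (simp add: insert_commute insert_Diff_if algebra_simps)
qed

lemma operad_game: "operad game_operad"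
proof (rule operad.intro, goal_cases)
  \<comment> \<open>the cases in order: spaces (1), action (2--4), bilinearity (5, 6), unit (7--9),
    sequential (10) and parallel (11) associativity, equivariance (12)\<close>
  case (1 n)
  show ?case by (simp add: module_function_space)
next
  case (2 n \<sigma>)
  show ?case
    by (rule linear_mapI, erule game_act_closed[OF 2(2)]) (simp_all add: game_act[OF 2(2)])
next
  case (3 n x)
  show ?case by (simp add: game_act[OF permutes_id])
next
  case (4 n \<sigma> \<tau> x)
  show ?case
    by (simp add: game_act[OF 4(2)] game_act[OF 4(3)] game_act[OF permutes_compose[OF 4(3,2)]]
      vimage_comp)
next
  case (5 n k i y)
  show ?case
    by (rule linear_mapI, unfold game_operad_simps(2), erule game_comp_closed[OF _ 5(4)])
      (auto simp: game_comp_def marginal_def algebra_simps)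
next
  case (6 n k i x)
  show ?case
    by (rule linear_mapI, unfold game_operad_simps(2), erule game_comp_closed[OF 6(4)])
      (auto simp: game_comp_def marginal_def algebra_simps)
next
  case 7
  show ?case by auto
next
  case (8 n x)
  show ?case
  proof
    fix S
    show "opcomp game_operad 1 n 1 (opunit game_operad) x S = x S"
    proof (cases "S \<subseteq> {1..n}")
      case True
      then have "outer_part 1 n 1 S = {}" "inner_part n 1 S = S"
        by (auto simp: outer_part_def inner_part_def inner_pos_def)
      then show ?thesis using True by (simp add: game_comp_def marginal_def)
    qed (use 8 in \<open>auto simp: game_comp_def\<close>)
  qed
next
  case (9 n i x)
  show ?case
  proof
    fix S
    show "opcomp game_operad n 1 i x (opunit game_operad) S = x S"
    proof (cases "S \<subseteq> {1..n}")
      case True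
      then have "outer_part n 1 i S = S - {i}" "inner_part 1 i S = (if i \<in> S then {1} else {})"
        using 9 by (auto simp: outer_part_def inner_part_def inner_pos_def outer_pos_def)
      then show ?thesis using True by (simp add: game_comp_def marginal_def insert_absorb)
    qed (use 9 in \<open>auto simp: game_comp_def\<close>)
  qed
next
  case 10
  then show ?case unfolding game_operad_simps by (intro game_comp_sequential)
next
  case 11
  then show ?case unfolding game_operad_simps by (intro game_comp_parallel)
next
  case (12 n k i \<sigma> \<tau> x y)
  show ?case
    unfolding game_operad_simps game_act[OF 12(4)] game_act[OF 12(5)]
      game_act[OF perm_comp_permutes[OF 12(3-5)]] game_comp_equivariant[OF 12(3-5)] ..
qed

section \<open>Additive games and the partial tensor operad\<close>

text \<open>
  The weights \<open>x\<close> are then necessarily the values on single players.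
\<close>

lemma additive_gamesI:
  assumes "v \<in> ops game_operad n" and sum: "\<And>S. S \<subseteq> {1..n} \<Longrightarrow> v S = (\<Sum>j\<in>S. x j)"
  shows "v \<in> additive_games n"
proof -
  have "v S = (\<Sum>j\<in>S. v {j})" if "S \<subseteq> {1..n}" for S
  proof -
    have "(\<Sum>j\<in>S. v {j}) = (\<Sum>j\<in>S. x j)" using that sum by (intro sum.cong) auto
    then show ?thesis using sum[OF that] by simp
  qed
  then show ?thesis using assms(1) by (simp add: additive_games_def)
qed

lemma additive_gamesD:
  assumes "v \<in> additive_games n"
  shows "v \<in> ops game_operad n" "S \<subseteq> {1..n} \<Longrightarrow> v S = (\<Sum>j\<in>S. v {j})"
  using assms unfolding additive_games_def by blast+

lemma marginal_additive:
  assumes v: "v \<in> additive_games n" and T: "T \<subseteq> {1..n}" and i: "i \<in> {1..n}"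
  shows "marginal i v T = v {i}"
proof -
  have "finite T" using T finite_subset by blast
  moreover have "insert i T \<subseteq> {1..n}" "T - {i} \<subseteq> {1..n}" using T i by auto
  ultimately show ?thesis
    using additive_gamesD(2)[OF v, of "insert i T"] additive_gamesD(2)[OF v, of "T - {i}"]
    by (simp add: marginal_def sum.insert_remove)
qed

lemma sum_parts:
  fixes f :: "nat \<Rightarrow> real"
  assumes i: "i \<in> {1..n}" and S: "S \<subseteq> {1..n + k - 1}"
  shows "(\<Sum>p\<in>S. f p) =
    (\<Sum>j\<in>outer_part n k i S. f (outer_pos i k j)) + (\<Sum>q\<in>inner_part k i S. f (inner_pos i q))"
proof -
  let ?A = "outer_pos i k ` outer_part n k i S" and ?B = "inner_pos i ` inner_part k i S"
  have "p \<in> ?A \<union> ?B" if "p \<in> S" for p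
    using subsetD[OF S that] i
    by (cases rule: pos_cases) (use that in \<open>auto simp: outer_part_def inner_part_def\<close>)
  then have "S = ?A \<union> ?B" by (auto simp: outer_part_def inner_part_def)
  moreover have "?A \<subseteq> - {i..<i + k}"
    using outer_pos_bounds(2)[OF _ i] outer_part_subset[of n k i S] by blast
  moreover have "?B \<subseteq> {i..<i + k}"
    using inner_pos_bounds(2)[OF _ i] inner_part_subset[of k i S] by blast
  ultimately have "?A \<inter> ?B = {}" "S = ?A \<union> ?B" by blast+
  moreover have "finite S" using S finite_subset by blast
  ultimately have "sum f S = sum f ?A + sum f ?B" by (metis sum.union_disjoint finite_Un)
  moreover have "inj_on (outer_pos i k) (outer_part n k i S)" "inj_on (inner_pos i) (inner_part k i S)"
    by (auto simp: inj_on_def outer_part_def outer_pos_def inner_part_def inner_pos_def split: if_splits)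
  ultimately show ?thesis by (simp add: sum.reindex)
qed

lemma tensor_comp_outer:
  "j \<in> {1..n} - {i} \<Longrightarrow> tensor_comp n k i x y (outer_pos i k j) = (\<Sum>l = 1..k. y l) * x j"
  by (auto simp: tensor_comp_def outer_pos_def Let_def)

lemma tensor_comp_inner:
  "q \<in> {1..k} \<Longrightarrow> tensor_comp n k i x y (inner_pos i q) = x i * y q"
  by (auto simp: tensor_comp_def inner_pos_def Let_def)

lemma tensor_comp_outside:
  assumes "i \<in> {1..n}" "p \<notin> {1..n + k - 1}" "\<And>j. j \<notin> {1..n} \<Longrightarrow> x j = 0"
  shows "tensor_comp n k i x y p = 0"
proof -
  have "p = 0 \<or> (i + k \<le> p \<and> p + 1 - k \<notin> {1..n})" using assms(1,2) by auto
  then show ?thesis using assms by (auto simp: tensor_comp_def Let_def)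
qed

text \<open>
  For additive games the marginal is constant, so the composition formula is a sum over the players of the
  coalition. This one computation yields both closure of additive games under composition and the
  agreement with the partial tensor product.
\<close>

lemma game_comp_additive:
  assumes i: "i \<in> {1..n}" and v: "v \<in> additive_games n" and w: "w \<in> additive_games k"
    and S: "S \<subseteq> {1..n + k - 1}"
  shows "game_comp n k i v w S = (\<Sum>p\<in>S. tensor_comp n k i (\<lambda>j. v {j}) (\<lambda>q. w {q}) p)"
proof -
  let ?O = "outer_part n k i S" and ?I = "inner_part k i S"
  let ?t = "tensor_comp n k i (\<lambda>j. v {j}) (\<lambda>q. w {q})"
  have O: "?O \<subseteq> {1..n}" using outer_part_subset by blast
  have "(\<Sum>j\<in>?O. ?t (outer_pos i k j)) = (\<Sum>j\<in>?O. w {1..k} * v {j})"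
    unfolding additive_gamesD(2)[OF w order_refl]
    by (intro sum.cong refl tensor_comp_outer) (use outer_part_subset in blast)
  moreover have "(\<Sum>q\<in>?I. ?t (inner_pos i q)) = (\<Sum>q\<in>?I. v {i} * w {q})"
    by (intro sum.cong refl tensor_comp_inner) (use inner_part_subset in blast)
  ultimately have "(\<Sum>p\<in>S. ?t p) = w {1..k} * v ?O + v {i} * w ?I"
    unfolding sum_parts[OF i S] additive_gamesD(2)[OF v O] additive_gamesD(2)[OF w inner_part_subset]
    by (simp add: sum_distrib_left)
  then show ?thesis using S by (simp add: game_comp_def marginal_additive[OF v O i])
qed

lemma game_act_singleton:
  assumes "\<sigma> permutes A"
  shows "opact game_operad n \<sigma> v {j} = v {inv_into UNIV \<sigma> j}"
  by (simp add: game_operad_def)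

lemma suboperad_additive_games: "suboperad game_operad additive_games"
  unfolding suboperad_def
proof (intro conjI allI impI ballI)
  fix n :: nat assume "1 \<le> n"
  show "submodule (additive_games n) real_field (opspace game_operad n)"
    unfolding game_operad_simps submodule_iff[OF module_function_space]
    by (auto simp: additive_games_def sum.distrib sum_distrib_left)
next
  fix n \<sigma> v assume *: "1 \<le> n" "\<sigma> permutes {1..n}" "v \<in> additive_games n"
  show "opact game_operad n \<sigma> v \<in> additive_games n"
  proof (rule additive_gamesI)
    show "opact game_operad n \<sigma> v \<in> ops game_operad n"
      using game_act_closed[OF *(2) additive_gamesD(1)[OF *(3)]] .
    fix S :: "nat set" assume S: "S \<subseteq> {1..n}"
    have inj: "inj_on (inv_into UNIV \<sigma>) S"
      using permutes_inj[OF permutes_inv[OF *(2)]] inj_on_subset by blast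
    have "inv_into UNIV \<sigma> ` S \<subseteq> {1..n}"
      using S permutes_in_image[OF permutes_inv[OF *(2)]] by blast
    then show "opact game_operad n \<sigma> v S = (\<Sum>j\<in>S. v {inv_into UNIV \<sigma> j})"
      using additive_gamesD(2)[OF *(3)] by (simp add: game_operad_def sum.reindex[OF inj])
  qed
next
  fix n k :: nat and i v w
  assume *: "1 \<le> n" "1 \<le> k" "i \<in> {1..n}" "v \<in> additive_games n" "w \<in> additive_games k"
  show "opcomp game_operad n k i v w \<in> additive_games (n + k - 1)"
    unfolding game_operad_simps(2)
    by (rule additive_gamesI[OF game_comp_closed game_comp_additive])
      (use * additive_gamesD(1) in \<open>auto simp del: game_operad_simps\<close>)
next
  show "opunit game_operad \<in> additive_games 1"
    by (rule additive_gamesI[where x = "\<lambda>j. 1"]) (auto simp: subset_singleton_iff)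
qed (rule operad_game)

lemma partial_tensor_operad_simps [simp]:
  "opspace partial_tensor_operad n = function_space {1..n}"
  "opact partial_tensor_operad n \<sigma> x = (\<lambda>j. x (inv_into UNIV \<sigma> j))"
  "opcomp partial_tensor_operad = tensor_comp"
  "opunit partial_tensor_operad = (\<lambda>j. if j = 1 then 1 else 0)"
  by (simp_all add: partial_tensor_operad_def)

abbreviation additive_game_operad :: "(nat set \<Rightarrow> real) operad" where
  "additive_game_operad \<equiv> restrict_operad game_operad additive_games"

lemma singleton_values_bij:
  "bij_betw (\<lambda>v j. v {j}) (additive_games n) (carrier (function_space {1..n}))"
proof (rule bij_betw_byWitness[where f' = "\<lambda>x S. if S \<subseteq> {1..n} then \<Sum>j\<in>S. x j else 0"])
  show "\<forall>v\<in>additive_games n. (\<lambda>S. if S \<subseteq> {1..n} then \<Sum>j\<in>S. v {j} else 0) = v"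
  proof
    fix v assume v: "v \<in> additive_games n"
    then have "v S = 0" if "\<not> S \<subseteq> {1..n}" for S
      using additive_gamesD(1)[OF v] that by auto
    then show "(\<lambda>S. if S \<subseteq> {1..n} then \<Sum>j\<in>S. v {j} else 0) = v"
      using additive_gamesD(2)[OF v] by (auto simp: fun_eq_iff)
  qed
  show "(\<lambda>v j. v {j}) ` additive_games n \<subseteq> carrier (function_space {1..n})"
    using additive_gamesD(1) by fastforce
  show "(\<lambda>x S. if S \<subseteq> {1..n} then \<Sum>j\<in>S. x j else 0) ` carrier (function_space {1..n})
    \<subseteq> additive_games n"
    by (rule image_subsetI, rule additive_gamesI) auto
qed auto

lemma operad_iso_games_tensor:
  "operad_iso additive_game_operad partial_tensor_operad (\<lambda>n v j. v {j})"
  unfolding operad_iso_def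
proof (intro conjI allI impI ballI)
  fix n :: nat assume "1 \<le> n"
  show "bij_betw (\<lambda>v j. v {j}) (ops additive_game_operad n) (ops partial_tensor_operad n)"
    using singleton_values_bij by simp
  then show "linear_map (opspace additive_game_operad n) (opspace partial_tensor_operad n) (\<lambda>v j. v {j})"
    by (intro linear_mapI) (auto dest: bij_betwE)
next
  fix n k :: nat and i v w
  assume *: "1 \<le> n" "1 \<le> k" "i \<in> {1..n}" "v \<in> ops additive_game_operad n" "w \<in> ops additive_game_operad k"
  then have v: "v \<in> additive_games n" and w: "w \<in> additive_games k" by simp_all
  show "(\<lambda>j. opcomp additive_game_operad n k i v w {j}) =
    opcomp partial_tensor_operad n k i (\<lambda>j. v {j}) (\<lambda>j. w {j})"
  proof
    fix p
    show "opcomp additive_game_operad n k i v w {p} =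
      opcomp partial_tensor_operad n k i (\<lambda>j. v {j}) (\<lambda>j. w {j}) p"
    proof (cases "p \<in> {1..n + k - 1}")
      case True
      then show ?thesis using game_comp_additive[OF *(3) v w, of "{p}"] by simp
    next
      case False
      have "v {j} = 0" if "j \<notin> {1..n}" for j using additive_gamesD(1)[OF v] that by auto
      then have "tensor_comp n k i (\<lambda>j. v {j}) (\<lambda>j. w {j}) p = 0"
        using tensor_comp_outside[OF *(3) False, of "\<lambda>j. v {j}"] by simp
      then show ?thesis using False by (auto simp: game_comp_def)
    qed
  qed
qed (auto simp: game_act_singleton)

lemma operad_additive_games: "operad additive_game_operad"
  by (rule operad_restrict[OF suboperad_additive_games])

lemma operad_partial_tensor: "operad partial_tensor_operad"
  by (rule operad_transport[OF operad_additive_games operad_iso_games_tensor]) simp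

section \<open>Labelled trees and their leftmost leaves\<close>

abbreviation root_leaf :: "'a btree \<Rightarrow> 'a" where
  "root_leaf t \<equiv> hd (leaves t)"

lemma leaves_nonempty [simp]: "leaves t \<noteq> []"
  by (induction t) auto

lemma leaves_map [simp]: "leaves (map_btree f t) = map f (leaves t)"
  by (induction t) auto

lemma map_btree_cong_leaves:
  "(\<And>x. x \<in> set (leaves t) \<Longrightarrow> f x = g x) \<Longrightarrow> map_btree f t = map_btree g t"
  by (induction t) auto

lemma root_leaf_in: "root_leaf t \<in> set (leaves t)"
  by simp

text \<open>
  The two subtrees of a node have fewer leaves than the node, as no tree is without leaves.
\<close>

lemma finite_trees_bounded:
  assumes "finite A"
  shows "finite {t. set (leaves t) \<subseteq> A \<and> length (leaves t) \<le> n}" (is "finite (?T n)")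
proof (induction n)
  case (Suc n)
  have "t \<in> Leaf ` A \<union> (\<lambda>(s, t). Node s t) ` (?T n \<times> ?T n)" if "t \<in> ?T (Suc n)" for t
  proof (cases t)
    case (Node a b)
    have "0 < length (leaves a)" "0 < length (leaves b)" by simp_all
    moreover have "length (leaves a) + length (leaves b) \<le> Suc n" using that Node by simp
    ultimately have "length (leaves a) \<le> n" "length (leaves b) \<le> n" by linarith+
    then show ?thesis using that Node by auto
  qed (use that in auto)
  then have "?T (Suc n) \<subseteq> Leaf ` A \<union> (\<lambda>(s, t). Node s t) ` (?T n \<times> ?T n)" by blast
  then show ?case using Suc assms by (meson finite_SigmaI finite_UnI finite_imageI finite_subset)
qed simp

lemma finite_labelled_trees [simp]: "finite (labelled_trees n)"
proof (rule finite_subset)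
  show "labelled_trees n \<subseteq> {t. set (leaves t) \<subseteq> {1..n} \<and> length (leaves t) \<le> n}"
    by (auto simp: labelled_trees_def dest!: distinct_card)
qed (rule finite_trees_bounded, simp)

lemma labelled_treesD:
  "t \<in> labelled_trees n \<Longrightarrow> distinct (leaves t)"
  "t \<in> labelled_trees n \<Longrightarrow> set (leaves t) = {1..n}"
  "t \<in> labelled_trees n \<Longrightarrow> root_leaf t \<in> {1..n}"
  using root_leaf_in[of t] by (auto simp: labelled_trees_def)

lemma map_labelled_tree:
  assumes "distinct (leaves t)" "bij_betw f (set (leaves t)) {1..n}"
  shows "map_btree f t \<in> labelled_trees n"
  using assms by (auto simp: labelled_trees_def distinct_map bij_betw_def)

lemma graft_absent:
  "i \<notin> set (leaves t) \<Longrightarrow> graft i k t u = map_btree (outer_pos i k) t"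
  by (induction t) auto

lemma set_leaves_graft:
  "set (leaves (graft i k t u)) = outer_pos i k ` (set (leaves t) - {i}) \<union>
    (if i \<in> set (leaves t) then inner_pos i ` set (leaves u) else {})"
  by (induction t) (auto simp: btree.set_map)

lemma distinct_leaves_graft:
  assumes "distinct (leaves t)" "i \<ge> 1" "distinct (leaves u)" "set (leaves u) \<subseteq> {1..k}" "k \<ge> 1"
  shows "distinct (leaves (graft i k t u))"
  using assms(1)
proof (induction t)
  case (Leaf j)
  have "inj_on (inner_pos i) (set (leaves u))" using assms by (auto simp: inj_on_def inner_pos_def)
  then show ?case using assms by (simp add: distinct_map)
next
  case (Node s t)
  have inj: "outer_pos i k a \<noteq> outer_pos i k b" if "a \<noteq> b" "a \<noteq> i" "b \<noteq> i" for a b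
    using that assms by (auto simp: outer_pos_def)
  have disj: "outer_pos i k a \<noteq> inner_pos i b" if "a \<noteq> i" "b \<in> set (leaves u)" for a b
    using that subsetD[OF assms(4) that(2)] assms(2) by (auto simp: outer_pos_def inner_pos_def)
  have "outer_pos i k a \<noteq> outer_pos i k b"
    if "a \<in> set (leaves s) - {i}" "b \<in> set (leaves t) - {i}" for a b
    using that Node.prems by (intro inj) auto
  then have "outer_pos i k ` (set (leaves s) - {i}) \<inter> outer_pos i k ` (set (leaves t) - {i}) = {}"
    by blast
  moreover have "outer_pos i k ` (set (leaves s) - {i}) \<inter> inner_pos i ` set (leaves u) = {}"
    "outer_pos i k ` (set (leaves t) - {i}) \<inter> inner_pos i ` set (leaves u) = {}"
    using disj by blast+
  moreover have "i \<notin> set (leaves s) \<or> i \<notin> set (leaves t)" using Node.prems by auto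
  ultimately have "set (leaves (graft i k s u)) \<inter> set (leaves (graft i k t u)) = {}"
    unfolding set_leaves_graft
    by (cases "i \<in> set (leaves s)"; cases "i \<in> set (leaves t)"; simp only: if_True if_False simp_thms; blast)
  then show ?case using Node by simp
qed

text \<open>
  The labels of a graft are the renumbered old and inserted inputs, hence all of \<open>{1..n + k - 1}\<close>.
\<close>

lemma graft_labelled:
  assumes t: "t \<in> labelled_trees n" and u: "u \<in> labelled_trees k" and i: "i \<in> {1..n}"
  shows "graft i k t u \<in> labelled_trees (n + k - 1)"
proof -
  have k: "k \<ge> 1" using labelled_treesD(3)[OF u] by auto
  have "set (leaves (graft i k t u)) = outer_pos i k ` ({1..n} - {i}) \<union> inner_pos i ` {1..k}"
    using i by (simp add: set_leaves_graft labelled_treesD(2)[OF t] labelled_treesD(2)[OF u])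
  also have "\<dots> = {1..n + k - 1}"
  proof
    show "{1..n + k - 1} \<subseteq> outer_pos i k ` ({1..n} - {i}) \<union> inner_pos i ` {1..k}"
      using i by (blast elim: pos_cases)
  qed (use outer_pos_bounds(1)[OF _ i] inner_pos_bounds(1)[OF _ i] in blast)
  finally show ?thesis
    using distinct_leaves_graft[OF labelled_treesD(1)[OF t] _ labelled_treesD(1)[OF u] _ k, of i]
      labelled_treesD(2)[OF u] i by (simp add: labelled_trees_def)
qed

text \<open>
  This is where planar trees meet the partial tensor operad: the rule is that for the partial tensor product
  of basis vectors.
\<close>

lemma root_leaf_graft:
  "root_leaf (graft i k t u) =
    (if root_leaf t = i then inner_pos i (root_leaf u) else outer_pos i k (root_leaf t))"
  by (induction t) (auto simp: hd_map hd_append)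

lemma free_magmatic_operad_simps [simp]:
  "opspace free_magmatic_operad n = function_space (labelled_trees n)"
  "opact free_magmatic_operad n \<sigma> f = (\<lambda>t. f (map_btree (inv_into UNIV \<sigma>) t))"
  "opunit free_magmatic_operad = tree_vec (Leaf 1)"
  by (simp_all add: free_magmatic_operad_def)

lemma free_comp:
  "opcomp free_magmatic_operad n k i f g u =
    (\<Sum>t\<in>labelled_trees n. \<Sum>s\<in>labelled_trees k. if graft i k t s = u then f t * g s else 0)"
  by (simp add: free_magmatic_operad_def)

lemma map_btree_inv:
  assumes "\<sigma> permutes A"
  shows "map_btree (inv_into UNIV \<sigma>) (map_btree \<sigma> t) = t"
    and "map_btree \<sigma> (map_btree (inv_into UNIV \<sigma>) t) = t"
  using permutes_inverses[OF assms] by (simp_all add: btree.map_comp comp_def btree.map_ident)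

lemma map_btree_permutes_labelled:
  assumes "\<sigma> permutes {1..n}"
  shows "map_btree \<sigma> t \<in> labelled_trees n \<longleftrightarrow> t \<in> labelled_trees n"
proof -
  have "(\<sigma> ` L = {1..n}) = (L = {1..n})" for L
    using inj_image_eq_iff[OF permutes_inj[OF assms], of L "{1..n}"]
    by (simp only: permutes_image[OF assms])
  then show ?thesis
    using permutes_inj_on[OF assms] by (simp add: labelled_trees_def distinct_map)
qed

lemma free_act_closed:
  assumes "\<sigma> permutes {1..n}" "f \<in> ops free_magmatic_operad n"
  shows "opact free_magmatic_operad n \<sigma> f \<in> ops free_magmatic_operad n"
  using assms(2) map_btree_permutes_labelled[OF permutes_inv[OF assms(1)]] by simp

lemma free_comp_closed:
  assumes "i \<in> {1..n}"
  shows "opcomp free_magmatic_operad n k i f g \<in> ops free_magmatic_operad (n + k - 1)"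
proof -
  have "opcomp free_magmatic_operad n k i f g u = 0" if "u \<notin> labelled_trees (n + k - 1)" for u
    unfolding free_comp using graft_labelled[OF _ _ assms] that
    by (intro sum.neutral ballI) auto
  then show ?thesis by simp
qed

lemma tree_vec_closed: "t \<in> labelled_trees n \<Longrightarrow> tree_vec t \<in> ops free_magmatic_operad n"
  by (auto simp: tree_vec_def)

lemma free_act_tree_vec:
  assumes "\<sigma> permutes A"
  shows "tree_vec t (map_btree (inv_into UNIV \<sigma>) u) = tree_vec (map_btree \<sigma> t) u"
  using map_btree_inv[OF assms] by (auto simp: tree_vec_def)

lemma free_comp_tree_right:
  assumes "s \<in> labelled_trees k"
  shows "opcomp free_magmatic_operad n k i f (tree_vec s) u =
    (\<Sum>t\<in>labelled_trees n. f t * tree_vec (graft i k t s) u)"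
proof -
  have "(\<Sum>s'\<in>labelled_trees k. if graft i k t s' = u then f t * tree_vec s s' else 0) =
    (\<Sum>s'\<in>labelled_trees k. if s' = s then f t * tree_vec (graft i k t s) u else 0)" for t
    by (rule sum.cong) (auto simp: tree_vec_def)
  then show ?thesis using assms by (simp add: free_comp sum.delta)
qed

lemma free_comp_tree_left:
  assumes "t \<in> labelled_trees n"
  shows "opcomp free_magmatic_operad n k i (tree_vec t) g u =
    (\<Sum>s\<in>labelled_trees k. g s * tree_vec (graft i k t s) u)"
proof -
  have "(\<Sum>s\<in>labelled_trees k. if graft i k t' s = u then tree_vec t t' * g s else 0) =
    (if t' = t then \<Sum>s\<in>labelled_trees k. g s * tree_vec (graft i k t s) u else 0)" for t'
    by (auto simp: tree_vec_def intro!: sum.neutral sum.cong)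
  then show ?thesis using assms by (simp add: free_comp sum.delta)
qed

lemma sum_tree_vec:
  assumes "t \<in> labelled_trees n"
  shows "(\<Sum>s\<in>labelled_trees n. tree_vec t s * f s) = f t"
proof -
  have "(\<Sum>s\<in>labelled_trees n. tree_vec t s * f s) = (\<Sum>s\<in>labelled_trees n. if s = t then f s else 0)"
    by (rule sum.cong) (auto simp: tree_vec_def)
  then show ?thesis using assms by simp
qed

text \<open>
  The linear map that sends a labelled tree to the basis vector of its leftmost label.
\<close>

definition root_sums :: "nat \<Rightarrow> (nat btree \<Rightarrow> real) \<Rightarrow> nat \<Rightarrow> real" where
  "root_sums n f j = (\<Sum>t\<in>labelled_trees n. if root_leaf t = j then f t else 0)"

lemma root_sums_tree_vec:
  assumes "t \<in> labelled_trees n"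
  shows "root_sums n (tree_vec t) j = (if root_leaf t = j then 1 else 0)"
proof -
  have "root_sums n (tree_vec t) j =
    (\<Sum>s\<in>labelled_trees n. tree_vec t s * (if root_leaf s = j then 1 else 0))"
    unfolding root_sums_def by (rule sum.cong) auto
  then show ?thesis unfolding sum_tree_vec[OF assms] .
qed

lemma root_sums_outside: "j \<notin> {1..n} \<Longrightarrow> root_sums n f j = 0"
  unfolding root_sums_def using labelled_treesD(3) by (intro sum.neutral) auto

lemma sum_root_sums: "(\<Sum>j = 1..n. root_sums n f j) = (\<Sum>t\<in>labelled_trees n. f t)"
  unfolding root_sums_def
  by (subst sum.swap) (use labelled_treesD(3) in \<open>auto intro!: sum.cong\<close>)

text \<open>
  Both sides are bilinear, so it is a matter of comparing, for trees \<open>t\<close> and \<open>s\<close>, when their graft has the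
  leftmost label \<open>p\<close>. The three cases are those in the definition of \<open>tensor_comp\<close>.
\<close>

lemma root_sums_comp:
  assumes i: "i \<in> {1..n}"
  shows "root_sums (n + k - 1) (opcomp free_magmatic_operad n k i f g) =
    tensor_comp n k i (root_sums n f) (root_sums k g)"
proof
  fix p
  let ?A = "labelled_trees n" and ?B = "labelled_trees k" and ?N = "labelled_trees (n + k - 1)"
  have "root_sums (n + k - 1) (opcomp free_magmatic_operad n k i f g) p =
    (\<Sum>u\<in>?N. \<Sum>t\<in>?A. \<Sum>s\<in>?B. if graft i k t s = u then if root_leaf u = p then f t * g s else 0 else 0)"
    unfolding root_sums_def free_comp by (auto intro!: sum.cong sum.neutral)
  also have "\<dots> = (\<Sum>t\<in>?A. \<Sum>s\<in>?B. \<Sum>u\<in>?N.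
      if graft i k t s = u then if root_leaf u = p then f t * g s else 0 else 0)"
    by (subst sum.swap, rule sum.cong[OF refl], rule sum.swap)
  also have "\<dots> = (\<Sum>t\<in>?A. \<Sum>s\<in>?B. if root_leaf (graft i k t s) = p then f t * g s else 0)"
    using graft_labelled[OF _ _ i] by (intro sum.cong refl) (simp add: sum.delta')
  also have "\<dots> = tensor_comp n k i (root_sums n f) (root_sums k g) p"
  proof -
    have prod: "sum g ?B * root_sums n f q =
      (\<Sum>t\<in>?A. \<Sum>s\<in>?B. (if root_leaf t = q then f t else 0) * g s)" for q
      unfolding root_sums_def mult.commute[of "sum g ?B"] by (rule sum_product)
    consider "p < i" | "i \<le> p" "p < i + k" | "i + k \<le> p" by linarith
    then show ?thesis
    proof cases
      case 1
      have "root_leaf (graft i k t s) = p \<longleftrightarrow> root_leaf t = p" if "s \<in> ?B" for t s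
        using 1 labelled_treesD(3)[OF that]
        by (auto simp: root_leaf_graft outer_pos_def inner_pos_def)
      then have "(\<Sum>t\<in>?A. \<Sum>s\<in>?B. if root_leaf (graft i k t s) = p then f t * g s else 0) =
        (\<Sum>t\<in>?A. \<Sum>s\<in>?B. (if root_leaf t = p then f t else 0) * g s)"
        by (intro sum.cong refl) auto
      then show ?thesis
        using 1 prod[of p] sum_root_sums[of k g] by (simp add: tensor_comp_def)
    next
      case 2
      have "root_leaf (graft i k t s) = p \<longleftrightarrow> root_leaf t = i \<and> root_leaf s = p + 1 - i"
        if "s \<in> ?B" for t s
        using 2 labelled_treesD(3)[OF that]
        by (auto simp: root_leaf_graft outer_pos_def inner_pos_def)
      then have "(\<Sum>t\<in>?A. \<Sum>s\<in>?B. if root_leaf (graft i k t s) = p then f t * g s else 0) =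
        (\<Sum>t\<in>?A. \<Sum>s\<in>?B. (if root_leaf t = i then f t else 0) *
          (if root_leaf s = p + 1 - i then g s else 0))"
        by (intro sum.cong refl) auto
      then show ?thesis
        using 2 by (simp add: tensor_comp_def root_sums_def sum_product)
    next
      case 3
      have "root_leaf (graft i k t s) = p \<longleftrightarrow> root_leaf t = p + 1 - k" if "s \<in> ?B" for t s
        using 3 i labelled_treesD(3)[OF that]
        by (auto simp: root_leaf_graft outer_pos_def inner_pos_def)
      then have "(\<Sum>t\<in>?A. \<Sum>s\<in>?B. if root_leaf (graft i k t s) = p then f t * g s else 0) =
        (\<Sum>t\<in>?A. \<Sum>s\<in>?B. (if root_leaf t = p + 1 - k then f t else 0) * g s)"
        by (intro sum.cong refl) auto
      then show ?thesis
        using 3 prod[of "p + 1 - k"] sum_root_sums[of k g] by (simp add: tensor_comp_def)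
    qed
  qed
  finally show "root_sums (n + k - 1) (opcomp free_magmatic_operad n k i f g) p =
    tensor_comp n k i (root_sums n f) (root_sums k g) p" .
qed

lemma root_sums_act:
  assumes "\<sigma> permutes {1..n}"
  shows "root_sums n (opact free_magmatic_operad n \<sigma> f) j = root_sums n f (inv_into UNIV \<sigma> j)"
  unfolding root_sums_def
proof (rule sum.reindex_bij_witness[where i = "map_btree \<sigma>" and j = "map_btree (inv_into UNIV \<sigma>)"])
  fix t assume "t \<in> labelled_trees n"
  have "inv_into UNIV \<sigma> (root_leaf t) = inv_into UNIV \<sigma> j \<longleftrightarrow> root_leaf t = j"
    using permutes_inj[OF permutes_inv[OF assms]] by (auto dest: injD)
  then show "(if root_leaf (map_btree (inv_into UNIV \<sigma>) t) = inv_into UNIV \<sigma> j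
      then f (map_btree (inv_into UNIV \<sigma>) t) else 0) =
    (if root_leaf t = j then opact free_magmatic_operad n \<sigma> f t else 0)"
    by (simp add: hd_map)
qed (simp_all add: map_btree_inv[OF assms] map_btree_permutes_labelled[OF assms]
  map_btree_permutes_labelled[OF permutes_inv[OF assms]])

section \<open>The permutative congruence on planar trees\<close>

text \<open>
  Left combs \<open>((s y\<^sub>1) y\<^sub>2) \<dots> y\<^sub>k\<close> over a leaf \<open>s\<close> are the normal forms of trees
  for the permutative relations; they are unique up to the order of the \<open>y\<close>.
\<close>

definition left_comb :: "'a btree \<Rightarrow> 'a list \<Rightarrow> 'a btree" where
  "left_comb s ys = foldl (\<lambda>s y. Node s (Leaf y)) s ys"

lemma left_comb_simps [simp]:
  "left_comb s [] = s"
  "left_comb s (y # ys) = left_comb (Node s (Leaf y)) ys"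
  "left_comb s (ys @ zs) = left_comb (left_comb s ys) zs"
  by (simp_all add: left_comb_def)

lemma leaves_left_comb: "leaves (left_comb s ys) = leaves s @ ys"
  by (induction ys arbitrary: s) simp_all

lemma exists_labelled_tree:
  assumes "j \<in> {1..n}"
  obtains t where "t \<in> labelled_trees n" "root_leaf t = j"
proof -
  have "finite ({1..n} - {j})" by simp
  from finite_distinct_list[OF this] obtain ys where ys: "set ys = {1..n} - {j}" "distinct ys"
    by blast
  have "insert j ({1..n} - {j}) = {1..n}" using assms by blast
  then have "left_comb (Leaf j) ys \<in> labelled_trees n" "root_leaf (left_comb (Leaf j) ys) = j"
    by (simp_all add: labelled_trees_def leaves_left_comb ys del: insert_Diff_single)
  then show thesis by (rule that)
qed

text \<open>
  The equivalence generated by the relations of the permutative operad, read as moves on trees. Replacement is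
  allowed in left subtrees, since that is where the reduction to the normal forms below takes place.
\<close>

inductive perm_equiv :: "'a btree \<Rightarrow> 'a btree \<Rightarrow> bool" (infix \<open>\<approx>\<close> 50) where
  equiv_refl: "t \<approx> t"
| equiv_sym: "s \<approx> t \<Longrightarrow> t \<approx> s"
| equiv_trans: "s \<approx> t \<Longrightarrow> t \<approx> u \<Longrightarrow> s \<approx> u"
| equiv_assoc: "Node (Node a b) c \<approx> Node a (Node b c)"
| equiv_comm: "Node a (Node b c) \<approx> Node a (Node c b)"
| equiv_left: "a \<approx> a' \<Longrightarrow> Node a b \<approx> Node a' b"

declare perm_equiv.equiv_trans [trans]

lemma perm_equiv_mset: "s \<approx> t \<Longrightarrow> mset (leaves s) = mset (leaves t)"
  by (induction rule: perm_equiv.induct) auto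

lemma left_comb_cong: "s \<approx> t \<Longrightarrow> left_comb s ys \<approx> left_comb t ys"
  by (induction ys arbitrary: s t) (simp_all add: perm_equiv.equiv_left)

lemma Node_equiv_left_comb: "Node s t \<approx> left_comb s (leaves t)"
proof (induction t arbitrary: s)
  case (Node a b)
  have "Node s (Node a b) \<approx> Node (Node s a) b" by (rule perm_equiv.equiv_sym, rule perm_equiv.equiv_assoc)
  also have "\<dots> \<approx> left_comb (Node s a) (leaves b)" by (rule Node.IH)
  also have "\<dots> \<approx> left_comb (left_comb s (leaves a)) (leaves b)" by (rule left_comb_cong, rule Node.IH)
  finally show ?case by simp
qed (simp add: perm_equiv.equiv_refl)

lemma equiv_left_comb: "t \<approx> left_comb (Leaf (root_leaf t)) (tl (leaves t))"
proof (induction t)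
  case (Node a b)
  have "Node a b \<approx> left_comb a (leaves b)" by (rule Node_equiv_left_comb)
  also have "\<dots> \<approx> left_comb (left_comb (Leaf (root_leaf a)) (tl (leaves a))) (leaves b)"
    by (rule left_comb_cong, rule Node.IH)
  finally show ?case by simp
qed (simp add: perm_equiv.equiv_refl)

text \<open>
  Associativity moves two neighbouring leaves of a comb into a common right branch, where they may be
  exchanged.
\<close>

lemma left_comb_swap: "Node (Node s (Leaf y)) (Leaf z) \<approx> Node (Node s (Leaf z)) (Leaf y)"
proof -
  have "Node (Node s (Leaf y)) (Leaf z) \<approx> Node s (Node (Leaf y) (Leaf z))" by (rule perm_equiv.equiv_assoc)
  also have "\<dots> \<approx> Node s (Node (Leaf z) (Leaf y))" by (rule perm_equiv.equiv_comm)
  also have "\<dots> \<approx> Node (Node s (Leaf z)) (Leaf y)" by (rule perm_equiv.equiv_sym, rule perm_equiv.equiv_assoc)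
  finally show ?thesis .
qed

lemma left_comb_move: "left_comb s (zs @ [y]) \<approx> left_comb (Node s (Leaf y)) zs"
proof (induction zs arbitrary: s)
  case (Cons z zs)
  have "left_comb s ((z # zs) @ [y]) \<approx> left_comb (Node (Node s (Leaf z)) (Leaf y)) zs"
    using Cons.IH by simp
  also have "\<dots> \<approx> left_comb (Node (Node s (Leaf y)) (Leaf z)) zs"
    by (rule left_comb_cong, rule left_comb_swap)
  finally show ?case by simp
qed (simp add: perm_equiv.equiv_refl)

lemma left_comb_perm: "mset ys = mset zs \<Longrightarrow> left_comb s ys \<approx> left_comb s zs"
proof (induction ys arbitrary: s zs)
  case (Cons y ys)
  then have "y \<in> set zs" by (metis list.set_intros(1) mset_eq_setD)
  then obtain zs1 zs2 where zs: "zs = zs1 @ y # zs2" by (meson split_list)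
  have "left_comb (Node s (Leaf y)) ys \<approx> left_comb (Node s (Leaf y)) (zs1 @ zs2)"
    using Cons.prems zs by (intro Cons.IH) simp
  also have "\<dots> \<approx> left_comb (left_comb s (zs1 @ [y])) zs2"
    unfolding left_comb_simps(3)[of "Node s (Leaf y)"]
    by (rule left_comb_cong, rule perm_equiv.equiv_sym, rule left_comb_move)
  finally show ?case by (simp add: zs)
qed (simp add: perm_equiv.equiv_refl)

text \<open>
  Both trees reduce to left combs over the same leftmost leaf, whose other leaves agree up to order.
\<close>

theorem perm_equivI:
  assumes "root_leaf s = root_leaf t" "mset (leaves s) = mset (leaves t)"
  shows "s \<approx> t"
proof -
  have "leaves u = root_leaf u # tl (leaves u)" for u :: "'a btree" by simp
  then have "mset (tl (leaves s)) = mset (tl (leaves t))"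
    using assms by (metis mset.simps(2) add_mset_add_mset_same_iff)
  then have "left_comb (Leaf (root_leaf s)) (tl (leaves s)) \<approx> left_comb (Leaf (root_leaf t)) (tl (leaves t))"
    unfolding assms(1) by (rule left_comb_perm)
  then show ?thesis
    using equiv_left_comb[of s] equiv_left_comb[of t] by (meson perm_equiv.equiv_trans perm_equiv.equiv_sym)
qed

section \<open>Ideals of the free operad that contain the permutative relations\<close>

definition tree_diff :: "nat btree \<Rightarrow> nat btree \<Rightarrow> nat btree \<Rightarrow> real" where
  "tree_diff s t = (\<lambda>u. tree_vec s u - tree_vec t u)"

lemma tree_diff_act:
  assumes "\<sigma> permutes A"
  shows "opact free_magmatic_operad n \<sigma> (tree_diff s t) = tree_diff (map_btree \<sigma> s) (map_btree \<sigma> t)"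
  using free_act_tree_vec[OF assms] by (simp add: tree_diff_def fun_eq_iff)

lemma tree_diff_graft_left:
  assumes "s \<in> labelled_trees n" "t \<in> labelled_trees n" "u \<in> labelled_trees k"
  shows "opcomp free_magmatic_operad n k i (tree_diff s t) (tree_vec u) =
    tree_diff (graft i k s u) (graft i k t u)"
  by (simp add: fun_eq_iff free_comp_tree_right[OF assms(3)] tree_diff_def left_diff_distrib
    sum_subtractf sum_tree_vec assms(1,2))

lemma tree_diff_graft_right:
  assumes "u \<in> labelled_trees n" "s \<in> labelled_trees k" "t \<in> labelled_trees k"
  shows "opcomp free_magmatic_operad n k i (tree_vec u) (tree_diff s t) =
    tree_diff (graft i k u s) (graft i k u t)"
  by (simp add: fun_eq_iff free_comp_tree_left[OF assms(1)] tree_diff_def left_diff_distrib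
    sum_subtractf sum_tree_vec assms(2,3))

lemma free_comp_tree_vec:
  assumes "t \<in> labelled_trees n" "s \<in> labelled_trees k"
  shows "opcomp free_magmatic_operad n k i (tree_vec t) (tree_vec s) = tree_vec (graft i k t s)"
  by (simp add: fun_eq_iff free_comp_tree_left[OF assms(1)] sum_tree_vec assms)

lemma labelled_trees_Node:
  "Node (Leaf 1) (Leaf 2) \<in> labelled_trees 2"
  "Node (Node (Leaf 1) (Leaf 2)) (Leaf 3) \<in> labelled_trees 3"
  "Node (Leaf 1) (Node (Leaf 2) (Leaf 3)) \<in> labelled_trees 3"
  "Node (Leaf 1) (Node (Leaf 3) (Leaf 2)) \<in> labelled_trees 3"
  by (auto simp: labelled_trees_def)

lemma perm_relators_eq:
  "perm_relators 3 =
    {tree_diff (Node (Node (Leaf 1) (Leaf 2)) (Leaf 3)) (Node (Leaf 1) (Node (Leaf 2) (Leaf 3))),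
     tree_diff (Node (Leaf 1) (Node (Leaf 2) (Leaf 3))) (Node (Leaf 1) (Node (Leaf 3) (Leaf 2)))}"
proof -
  have swap: "transpose 1 2 permutes {1..2::nat}" by (rule permutes_swap_id) auto
  let ?comp = "opcomp free_magmatic_operad 2 2"
  have swap_rho: "opact free_magmatic_operad 2 (transpose 1 2) rho = tree_vec (Node (Leaf 2) (Leaf 1))"
    unfolding free_magmatic_operad_simps(2) rho_def free_act_tree_vec[OF swap] by simp
  have swapped: "Node (Leaf 2) (Leaf 1) \<in> labelled_trees 2" by (auto simp: labelled_trees_def)
  have comps: "?comp 1 rho rho = tree_vec (Node (Node (Leaf 1) (Leaf 2)) (Leaf 3))"
    "?comp 2 rho rho = tree_vec (Node (Leaf 1) (Node (Leaf 2) (Leaf 3)))"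
    "?comp 2 rho (tree_vec (Node (Leaf 2) (Leaf 1))) = tree_vec (Node (Leaf 1) (Node (Leaf 3) (Leaf 2)))"
    unfolding rho_def free_comp_tree_vec[OF labelled_trees_Node(1) labelled_trees_Node(1)]
      free_comp_tree_vec[OF labelled_trees_Node(1) swapped]
    by (simp_all add: outer_pos_def inner_pos_def numeral_2_eq_2 numeral_3_eq_3)
  have diff: "tree_vec s \<ominus>\<^bsub>opspace free_magmatic_operad 3\<^esub> tree_vec t = tree_diff s t"
    if "s \<in> labelled_trees 3" "t \<in> labelled_trees 3" for s t
    using function_space_minus[of "tree_vec s" "labelled_trees 3" "tree_vec t"] that
    by (auto simp: tree_diff_def tree_vec_def)
  show ?thesis
    unfolding perm_relators_def Let_def swap_rho comps diff[OF labelled_trees_Node(2,3)]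
      diff[OF labelled_trees_Node(3,4)]
    by (simp only: if_True simp_thms)
qed

text \<open>
  The numbering of the leaves of a node that numbers the left subtree by \<open>g\<close> and then continues with the
  right subtree, numbered by \<open>h\<close> and shifted by the number \<open>p\<close> of leaves on the left.
\<close>

definition juxtapose ::
  "'a set \<Rightarrow> nat \<Rightarrow> ('a \<Rightarrow> nat) \<Rightarrow> ('a \<Rightarrow> nat) \<Rightarrow> 'a \<Rightarrow> nat" where
  "juxtapose A p g h x = (if x \<in> A then g x else p + h x)"

lemma bij_betw_juxtapose:
  assumes g: "bij_betw g A {1..p}" and h: "bij_betw h B {1..q}" and AB: "A \<inter> B = {}"
  shows "bij_betw (juxtapose A p g h) (A \<union> B) {1..p + q}"
proof -
  have "bij_betw (juxtapose A p g h) A {1..p}"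
    using g by (subst bij_betw_cong[where g = g]) (simp_all add: juxtapose_def)
  moreover have "bij_betw (juxtapose A p g h) B {p + 1..p + q}"
  proof -
    have "bij_betw ((\<lambda>y. p + y) \<circ> h) B {p + 1..p + q}"
      by (rule bij_betw_trans[OF h]) (simp add: bij_betw_def)
    then show ?thesis
      using AB by (subst bij_betw_cong[where g = "(\<lambda>y. p + y) \<circ> h"]) (auto simp: juxtapose_def)
  qed
  moreover have "{1..p} \<inter> {p + 1..p + q} = {}" by auto
  moreover have "{1..p} \<union> {p + 1..p + q} = {1..p + q}" by auto
  ultimately show ?thesis using bij_betw_combine by metis
qed

lemma numbering_pos:
  fixes n :: nat
  assumes "bij_betw f (set (leaves t)) {1..n}"
  shows "n \<ge> 1"
  using assms leaves_nonempty[of t] by (cases n) (auto simp: bij_betw_def)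

lemma obtain_numbering:
  assumes "distinct xs"
  obtains g where "bij_betw g (set xs) {1..length xs}"
  using finite_same_card_bij[of "set xs" "{1..length xs}"] assms by (auto simp: distinct_card)

primrec subst_btree :: "('a \<Rightarrow> 'b btree) \<Rightarrow> 'a btree \<Rightarrow> 'b btree" where
  "subst_btree f (Leaf j) = f j"
| "subst_btree f (Node s t) = Node (subst_btree f s) (subst_btree f t)"

lemma set_leaves_subst: "set (leaves (subst_btree f t)) = (\<Union>j\<in>set (leaves t). set (leaves (f j)))"
  by (induction t) auto

locale perm_ideal =
  fixes I :: "nat \<Rightarrow> (nat btree \<Rightarrow> real) set"
  assumes ideal: "operad_ideal free_magmatic_operad I"
    and relators: "perm_relators 3 \<subseteq> I 3"
begin

lemma ideal_submodule:
  assumes "n \<ge> 1"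
  shows "(\<lambda>x. 0) \<in> I n"
    and "\<lbrakk>f \<in> I n; g \<in> I n\<rbrakk> \<Longrightarrow> (\<lambda>x. f x + g x) \<in> I n"
    and "f \<in> I n \<Longrightarrow> (\<lambda>x. c * f x) \<in> I n"
proof -
  have "submodule (I n) real_field (function_space (labelled_trees n))"
    using ideal assms by (simp add: operad_ideal_def)
  then show "(\<lambda>x. 0) \<in> I n" "\<lbrakk>f \<in> I n; g \<in> I n\<rbrakk> \<Longrightarrow> (\<lambda>x. f x + g x) \<in> I n"
    "f \<in> I n \<Longrightarrow> (\<lambda>x. c * f x) \<in> I n"
    unfolding submodule_iff[OF module_function_space] by auto
qed

lemma ideal_sum:
  assumes "n \<ge> 1" "finite A" "\<And>a. a \<in> A \<Longrightarrow> f a \<in> I n"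
  shows "(\<lambda>x. \<Sum>a\<in>A. c a * f a x) \<in> I n"
  using assms(2,3)
proof (induction A)
  case (insert a A)
  then show ?case
    using ideal_submodule(2,3)[OF assms(1)] by simp
qed (simp add: ideal_submodule(1)[OF assms(1)])

lemma diff_act:
  assumes "n \<ge> 1" "\<sigma> permutes {1..n}" "tree_diff s t \<in> I n"
  shows "tree_diff (map_btree \<sigma> s) (map_btree \<sigma> t) \<in> I n"
  using ideal assms unfolding operad_ideal_def tree_diff_act[OF assms(2), of n, symmetric] by blast

lemma diff_graft_left:
  assumes "n \<ge> 1" "k \<ge> 1" "i \<in> {1..n}" "s \<in> labelled_trees n" "t \<in> labelled_trees n"
    "u \<in> labelled_trees k" "tree_diff s t \<in> I n"
  shows "tree_diff (graft i k s u) (graft i k t u) \<in> I (n + k - 1)"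
proof -
  have "opcomp free_magmatic_operad n k i (tree_diff s t) (tree_vec u) \<in> I (n + k - 1)"
    using ideal assms(1-3,7) tree_vec_closed[OF assms(6)] unfolding operad_ideal_def by blast
  then show ?thesis unfolding tree_diff_graft_left[OF assms(4-6)] .
qed

lemma diff_graft_right:
  assumes "n \<ge> 1" "k \<ge> 1" "i \<in> {1..n}" "u \<in> labelled_trees n" "s \<in> labelled_trees k"
    "t \<in> labelled_trees k" "tree_diff s t \<in> I k"
  shows "tree_diff (graft i k u s) (graft i k u t) \<in> I (n + k - 1)"
proof -
  have "opcomp free_magmatic_operad n k i (tree_vec u) (tree_diff s t) \<in> I (n + k - 1)"
    using ideal assms(1-3,7) tree_vec_closed[OF assms(4)] unfolding operad_ideal_def by blast
  then show ?thesis unfolding tree_diff_graft_right[OF assms(4-6)] .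
qed

text \<open>
  Congruence of trees modulo an ideal makes sense for trees whose leaves are numbered by an initial segment.
  Quantifying over all numberings extends it to trees with arbitrary distinct labels, in particular to
  subtrees, and lets one reason by induction on the moves.
\<close>

definition ideal_congruent :: "'a btree \<Rightarrow> 'a btree \<Rightarrow> bool" where
  "ideal_congruent s t \<longleftrightarrow> (\<forall>n f. bij_betw f (set (leaves s)) {1..n} \<longrightarrow>
     tree_diff (map_btree f s) (map_btree f t) \<in> I n)"

text \<open>
  One numbering suffices: any two differ by a permutation, and ideals are closed under the action.
\<close>

lemma ideal_congruentI:
  assumes g: "bij_betw g L {1..n}" and L: "set (leaves s) = L" "set (leaves t) = L"
    and diff: "tree_diff (map_btree g s) (map_btree g t) \<in> I n"
  shows "ideal_congruent s t"
  unfolding ideal_congruent_def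
proof (intro allI impI)
  fix m :: nat and f assume "bij_betw f (set (leaves s)) {1..m}"
  then have f: "bij_betw f L {1..m}" using L by simp
  have "m = n" using bij_betw_same_card[OF f] bij_betw_same_card[OF g] by simp
  have n: "n \<ge> 1" using numbering_pos[of g s] g L(1) by simp
  \<comment> \<open>the permutation that turns the numbering \<open>g\<close> into \<open>f\<close>\<close>
  define \<sigma> where "\<sigma> x = (if x \<in> {1..n} then f (inv_into L g x) else x)" for x
  have "bij_betw (f \<circ> inv_into L g) {1..n} {1..n}"
    using bij_betw_trans[OF bij_betw_inv_into[OF g] f] \<open>m = n\<close> by simp
  then have "bij_betw \<sigma> {1..n} {1..n}"
    by (subst bij_betw_cong[where g = "f \<circ> inv_into L g"]) (simp_all add: \<sigma>_def)
  then have \<sigma>: "\<sigma> permutes {1..n}" by (rule bij_imp_permutes) (simp only: \<sigma>_def if_False)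
  have "\<sigma> (g x) = f x" if "x \<in> L" for x
    using bij_betwE[OF g] bij_betw_inv_into_left[OF g] that by (simp add: \<sigma>_def)
  then have "map_btree \<sigma> (map_btree g u) = map_btree f u" if "set (leaves u) = L" for u
    unfolding btree.map_comp using that by (intro map_btree_cong_leaves) simp
  then show "tree_diff (map_btree f s) (map_btree f t) \<in> I m"
    using diff_act[OF n \<sigma> diff] L \<open>m = n\<close> by simp
qed

text \<open>
  A node is obtained by grafting its subtrees into the tree of \<open>\<rho>\<close>; an ideal absorbs such compositions.
\<close>

lemma ideal_congruent_left:
  assumes a: "ideal_congruent a a'" and leaves: "mset (leaves a) = mset (leaves a')"
    and distinct: "distinct (leaves (Node a b))"
  shows "ideal_congruent (Node a b) (Node a' b)"
proof -
  let ?p = "length (leaves a)" and ?q = "length (leaves b)"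
  let ?A = "set (leaves a)" and ?B = "set (leaves b)"
  obtain g where g: "bij_betw g ?A {1..?p}" using obtain_numbering distinct by auto
  obtain h where h: "bij_betw h ?B {1..?q}" using obtain_numbering distinct by auto
  have A': "set (leaves a') = ?A" using leaves by (metis mset_eq_setD)
  have da': "distinct (leaves a')" using leaves distinct mset_eq_imp_distinct_iff by auto
  let ?F = "juxtapose ?A ?p g h"
  \<comment> \<open>\<open>b\<close> sits at the second leaf of the tree of \<open>\<rho>\<close>; the first leaf is left for \<open>a\<close> and \<open>a'\<close>\<close>
  let ?T = "graft 2 ?q (Node (Leaf 1) (Leaf 2)) (map_btree h b)"
  have pq: "?p \<ge> 1" "?q \<ge> 1" by (simp_all add: Suc_le_eq)
  have hb: "map_btree h b \<in> labelled_trees ?q" using map_labelled_tree[OF _ h] distinct by simp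
  have T: "?T \<in> labelled_trees (2 + ?q - 1)" by (rule graft_labelled[OF labelled_trees_Node(1) hb]) simp
  have "tree_diff (map_btree g a) (map_btree g a') \<in> I ?p"
    using a g by (simp add: ideal_congruent_def)
  moreover have "map_btree g a \<in> labelled_trees ?p" "map_btree g a' \<in> labelled_trees ?p"
    using map_labelled_tree[of _ g] g A' da' distinct by auto
  ultimately have "tree_diff (graft 1 ?p ?T (map_btree g a)) (graft 1 ?p ?T (map_btree g a')) \<in>
    I (2 + ?q - 1 + ?p - 1)"
    using pq T by (intro diff_graft_right) auto
  moreover have "graft 1 ?p ?T (map_btree g u) = map_btree ?F (Node u b)" if "set (leaves u) = ?A" for u
  proof -
    have "map_btree (inner_pos 1) (map_btree g u) = map_btree ?F u"
      unfolding btree.map_comp using that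
      by (intro map_btree_cong_leaves) (simp add: inner_pos_def juxtapose_def)
    moreover have "map_btree (inner_pos 2) (map_btree h b) = map_btree (\<lambda>x. h x + 1) b"
      unfolding btree.map_comp by (rule map_btree_cong_leaves) (simp add: inner_pos_def)
    moreover have "graft 1 ?p (map_btree (\<lambda>x. h x + 1) b) (map_btree g u) = map_btree ?F b"
    proof -
      have "x \<notin> ?A" "h x \<noteq> 0" if "x \<in> ?B" for x
        using that distinct bij_betwE[OF h] by force+
      moreover have "0 \<notin> h ` ?B" using h by (simp add: bij_betw_def)
      then have "1 \<notin> set (leaves (map_btree (\<lambda>x. h x + 1) b))"
        by (auto simp: image_iff)
      ultimately show ?thesis
        unfolding graft_absent[OF \<open>1 \<notin> _\<close>] btree.map_comp
        by (intro map_btree_cong_leaves) (auto simp: outer_pos_def juxtapose_def)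
    qed
    ultimately show ?thesis by (simp add: outer_pos_def)
  qed
  moreover have "2 + ?q - 1 + ?p - 1 = ?p + ?q" using pq by simp
  ultimately have diff: "tree_diff (map_btree ?F (Node a b)) (map_btree ?F (Node a' b)) \<in> I (?p + ?q)"
    using A' by metis
  show ?thesis
    by (rule ideal_congruentI[OF bij_betw_juxtapose[OF g h] _ _ diff]) (use distinct A' in auto)
qed

text \<open>
  A relation between trees with leaves \<open>1\<close>, \<open>2\<close>, \<open>3\<close> yields a relation between trees in which these leaves
  are replaced by arbitrary subtrees. Grafting is carried out at \<open>3\<close>, then \<open>2\<close>, then \<open>1\<close>, so that the
  positions still to be filled keep their numbers.
\<close>

lemma ideal_congruent_subst:
  assumes s: "s \<in> labelled_trees 3" and t: "t \<in> labelled_trees 3" and diff: "tree_diff s t \<in> I 3"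
    and distinct: "distinct (leaves a @ leaves b @ leaves c)"
  defines "sub \<equiv> (\<lambda>j. if j = 1 then a else if j = 2 then b else c)"
  shows "ideal_congruent (subst_btree sub s) (subst_btree sub t)"
proof -
  let ?p = "length (leaves a)" and ?q = "length (leaves b)" and ?r = "length (leaves c)"
  let ?A = "set (leaves a)" and ?B = "set (leaves b)" and ?C = "set (leaves c)"
  obtain g where g: "bij_betw g ?A {1..?p}" using obtain_numbering distinct by auto
  obtain h where h: "bij_betw h ?B {1..?q}" using obtain_numbering distinct by auto
  obtain l where l: "bij_betw l ?C {1..?r}" using obtain_numbering distinct by auto
  let ?F = "juxtapose ?A ?p g (juxtapose ?B ?q h l)"
  have "bij_betw (juxtapose ?B ?q h l) (?B \<union> ?C) {1..?q + ?r}"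
    using distinct by (intro bij_betw_juxtapose[OF h l]) auto
  then have F: "bij_betw ?F (?A \<union> (?B \<union> ?C)) {1..?p + (?q + ?r)}"
    using distinct by (intro bij_betw_juxtapose[OF g]) auto
  define G where "G u = graft 1 ?p (graft 2 ?q (graft 3 ?r u (map_btree l c)) (map_btree h b)) (map_btree g a)" for u
  have pqr: "?p \<ge> 1" "?q \<ge> 1" "?r \<ge> 1" by (simp_all add: Suc_le_eq)
  have ga: "map_btree g a \<in> labelled_trees ?p" using map_labelled_tree[OF _ g] distinct by simp
  have hb: "map_btree h b \<in> labelled_trees ?q" using map_labelled_tree[OF _ h] distinct by simp
  have lc: "map_btree l c \<in> labelled_trees ?r" using map_labelled_tree[OF _ l] distinct by simp
  have i: "3 \<in> {1..3::nat}" "2 \<in> {1..3 + ?r - 1}" "1 \<in> {1..3 + ?r - 1 + ?q - 1}"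
    and N: "1 \<le> (3::nat)" "1 \<le> 3 + ?r - 1" "1 \<le> 3 + ?r - 1 + ?q - 1" using pqr by auto
  note lab1 = graft_labelled[OF _ lc i(1)]
  note lab2 = graft_labelled[OF lab1 hb i(2)]
  have "tree_diff (G s) (G t) \<in> I (3 + ?r - 1 + ?q - 1 + ?p - 1)"
    unfolding G_def
    by (rule diff_graft_left[OF N(3) pqr(1) i(3) lab2[OF s] lab2[OF t] ga],
      rule diff_graft_left[OF N(2) pqr(2) i(2) lab1[OF s] lab1[OF t] hb],
      rule diff_graft_left[OF N(1) pqr(3) i(1) s t lc diff])
  moreover have "3 + ?r - 1 + ?q - 1 + ?p - 1 = ?p + (?q + ?r)" using pqr by simp
  moreover have "G u = map_btree ?F (subst_btree sub u)" if "set (leaves u) \<subseteq> {1..3}" for u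
    using that
  proof (induction u)
    case (Node x y)
    then show ?case by (simp add: G_def)
  next
    case (Leaf j)
    then consider "j = 1" | "j = 2" | "j = 3" by fastforce
    then show ?case
    proof cases
      case 1
      have "map_btree (inner_pos 1) (map_btree g a) = map_btree ?F a"
        unfolding btree.map_comp
        by (rule map_btree_cong_leaves) (simp add: inner_pos_def juxtapose_def)
      then show ?thesis using 1 by (simp add: G_def outer_pos_def sub_def)
    next
      case 2
      have inner: "map_btree (inner_pos 2) (map_btree h b) = map_btree (\<lambda>x. h x + 1) b"
        unfolding btree.map_comp by (rule map_btree_cong_leaves) (simp add: inner_pos_def)
      have B: "x \<notin> ?A" if "x \<in> ?B" for x using that distinct by auto
      have "0 \<notin> h ` ?B" using h by (simp add: bij_betw_def)
      then have absent: "1 \<notin> set (leaves (map_btree (\<lambda>x. h x + 1) b))"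
        by (auto simp: image_iff)
      have "graft 1 ?p (map_btree (inner_pos 2) (map_btree h b)) (map_btree g a) = map_btree ?F b"
        unfolding inner graft_absent[OF absent] unfolding btree.map_comp
        using B by (intro map_btree_cong_leaves) (auto simp: outer_pos_def juxtapose_def)
      then show ?thesis using 2 by (simp add: G_def outer_pos_def sub_def)
    next
      case 3
      have inner: "map_btree (inner_pos 3) (map_btree l c) = map_btree (\<lambda>x. l x + 2) c"
        unfolding btree.map_comp by (rule map_btree_cong_leaves) (simp add: inner_pos_def)
      have C: "x \<notin> ?A \<and> x \<notin> ?B" if "x \<in> ?C" for x using that distinct by auto
      have "0 \<notin> l ` ?C" using l by (simp add: bij_betw_def)
      then have absent2: "2 \<notin> set (leaves (map_btree (\<lambda>x. l x + 2) c))"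
        by (auto simp: image_iff)
      have outer: "map_btree (outer_pos 2 ?q) (map_btree (\<lambda>x. l x + 2) c) = map_btree (\<lambda>x. l x + ?q + 1) c"
        unfolding btree.map_comp by (rule map_btree_cong_leaves) (simp add: outer_pos_def)
      have absent1: "1 \<notin> set (leaves (map_btree (\<lambda>x. l x + ?q + 1) c))" using pqr by auto
      have "graft 1 ?p (graft 2 ?q (map_btree (inner_pos 3) (map_btree l c)) (map_btree h b))
        (map_btree g a) = map_btree ?F c"
        unfolding inner graft_absent[OF absent2] outer graft_absent[OF absent1]
        unfolding btree.map_comp
        using C by (intro map_btree_cong_leaves) (auto simp: outer_pos_def juxtapose_def)
      then show ?thesis using 3 by (simp add: G_def sub_def)
    qed
  qed
  ultimately have diff': "tree_diff (map_btree ?F (subst_btree sub s)) (map_btree ?F (subst_btree sub t))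
    \<in> I (?p + (?q + ?r))"
    using labelled_treesD(2)[OF s] labelled_treesD(2)[OF t] by (simp add: ac_simps)
  have "{1..3} = {1, 2, 3::nat}" by auto
  then have "set (leaves (subst_btree sub u)) = ?A \<union> (?B \<union> ?C)" if "u \<in> labelled_trees 3" for u
    by (simp add: set_leaves_subst labelled_treesD(2)[OF that] sub_def)
  then show ?thesis using ideal_congruentI[OF F _ _ diff'] s t by blast
qed

lemma perm_equiv_ideal_congruent: "s \<approx> t \<Longrightarrow> distinct (leaves s) \<Longrightarrow> ideal_congruent s t"
proof (induction rule: perm_equiv.induct)
  case (equiv_refl t)
  have "tree_diff u u = (\<lambda>x. 0)" for u by (simp add: tree_diff_def)
  moreover have "n \<ge> 1" if "bij_betw f (set (leaves t)) {1..n}" for f and n :: nat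
    using that by (rule numbering_pos)
  ultimately show ?case by (auto simp: ideal_congruent_def ideal_submodule(1))
next
  case (equiv_sym s t)
  have mset: "mset (leaves s) = mset (leaves t)" using perm_equiv_mset[OF equiv_sym.hyps] .
  then have st: "ideal_congruent s t" using equiv_sym mset_eq_imp_distinct_iff by blast
  show ?case
    unfolding ideal_congruent_def
  proof (intro allI impI)
    fix n :: nat and f assume f: "bij_betw f (set (leaves t)) {1..n}"
    then have "n \<ge> 1" by (rule numbering_pos)
    moreover have "tree_diff (map_btree f s) (map_btree f t) \<in> I n"
      using st f mset_eq_setD[OF mset] by (simp add: ideal_congruent_def)
    moreover have "tree_diff (map_btree f t) (map_btree f s) =
      (\<lambda>x. (-1) * tree_diff (map_btree f s) (map_btree f t) x)"
      by (simp add: tree_diff_def)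
    ultimately show "tree_diff (map_btree f t) (map_btree f s) \<in> I n"
      using ideal_submodule(3) by metis
  qed
next
  case (equiv_trans s t u)
  have mset: "mset (leaves s) = mset (leaves t)" using perm_equiv_mset[OF equiv_trans.hyps(1)] .
  then have st: "ideal_congruent s t" and tu: "ideal_congruent t u"
    using equiv_trans mset_eq_imp_distinct_iff by blast+
  show ?case
    unfolding ideal_congruent_def
  proof (intro allI impI)
    fix n :: nat and f assume f: "bij_betw f (set (leaves s)) {1..n}"
    then have "n \<ge> 1" by (rule numbering_pos)
    moreover have "tree_diff (map_btree f s) (map_btree f t) \<in> I n"
      "tree_diff (map_btree f t) (map_btree f u) \<in> I n"
      using st tu f mset_eq_setD[OF mset] by (simp_all add: ideal_congruent_def)
    moreover have "tree_diff (map_btree f s) (map_btree f u) =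
      (\<lambda>x. tree_diff (map_btree f s) (map_btree f t) x + tree_diff (map_btree f t) (map_btree f u) x)"
      by (simp add: tree_diff_def)
    ultimately show "tree_diff (map_btree f s) (map_btree f u) \<in> I n"
      using ideal_submodule(2) by metis
  qed
next
  case (equiv_assoc a b c)
  then show ?case
    using ideal_congruent_subst[OF labelled_trees_Node(2,3), of a b c] relators by (simp add: perm_relators_eq)
next
  case (equiv_comm a b c)
  then show ?case
    using ideal_congruent_subst[OF labelled_trees_Node(3,4), of a b c] relators by (simp add: perm_relators_eq)
next
  case (equiv_left a a' b)
  then show ?case
    using ideal_congruent_left[of a a' b] perm_equiv_mset[of a a'] by simp
qed

text \<open>
  Two labelled trees of the same arity carry the same labels, so only the leftmost leaf has to agree.
\<close>

lemma same_root_diff: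
  assumes s: "s \<in> labelled_trees n" and t: "t \<in> labelled_trees n" and root: "root_leaf s = root_leaf t"
  shows "tree_diff s t \<in> I n"
proof -
  have "mset (leaves s) = mset (leaves t)"
    using labelled_treesD(1,2)[OF s] labelled_treesD(1,2)[OF t] by (simp flip: set_eq_iff_mset_eq_distinct)
  then have "ideal_congruent s t"
    using perm_equiv_ideal_congruent[OF perm_equivI[OF root]] labelled_treesD(1)[OF s] by blast
  moreover have "bij_betw (\<lambda>x. x) (set (leaves s)) {1..n}"
    using labelled_treesD(2)[OF s] by (simp add: bij_betw_def)
  ultimately have "tree_diff (map_btree (\<lambda>x. x) s) (map_btree (\<lambda>x. x) t) \<in> I n"
    unfolding ideal_congruent_def by blast
  then show ?thesis by (simp only: btree.map_ident)
qed

text \<open>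
  Choose one tree \<open>r j\<close> for each leftmost label \<open>j\<close>. Replacing every tree \<open>t\<close> in \<open>f\<close> by the chosen tree with
  the same leftmost label gives a combination of the \<open>r j\<close> with the coefficients \<open>root_sums n f j = 0\<close>.
  So \<open>f\<close> is the combination of the differences made by the replacement, which lie in the ideal.
\<close>

lemma kernel_subset_ideal:
  assumes n: "n \<ge> 1" and f: "f \<in> ops free_magmatic_operad n" and kernel: "root_sums n f = (\<lambda>j. 0)"
  shows "f \<in> I n"
proof -
  let ?T = "labelled_trees n"
  have "\<forall>j\<in>{1..n}. \<exists>t. t \<in> ?T \<and> root_leaf t = j" using exists_labelled_tree by metis
  then obtain r where r: "\<And>j. j \<in> {1..n} \<Longrightarrow> r j \<in> ?T \<and> root_leaf (r j) = j" by metis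
  have "(\<lambda>u. \<Sum>t\<in>?T. f t * tree_diff t (r (root_leaf t)) u) \<in> I n"
    using r labelled_treesD(3) by (intro ideal_sum[OF n] same_root_diff) auto
  moreover have "(\<Sum>t\<in>?T. f t * tree_diff t (r (root_leaf t)) u) = f u" for u
  proof -
    have "(\<Sum>t\<in>?T. f t * tree_vec (r (root_leaf t)) u) =
      (\<Sum>t\<in>?T. \<Sum>j = 1..n. (if root_leaf t = j then f t else 0) * tree_vec (r j) u)"
    proof (rule sum.cong[OF refl])
      fix t assume "t \<in> ?T"
      have "(\<Sum>j = 1..n. (if root_leaf t = j then f t else 0) * tree_vec (r j) u) =
        (\<Sum>j = 1..n. if root_leaf t = j then f t * tree_vec (r j) u else 0)"
        by (rule sum.cong) auto
      also have "\<dots> = f t * tree_vec (r (root_leaf t)) u"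
        using labelled_treesD(3)[OF \<open>t \<in> ?T\<close>] by (simp add: sum.delta')
      finally show "f t * tree_vec (r (root_leaf t)) u =
        (\<Sum>j = 1..n. (if root_leaf t = j then f t else 0) * tree_vec (r j) u)" ..
    qed
    also have "\<dots> = (\<Sum>j = 1..n. root_sums n f j * tree_vec (r j) u)"
      by (subst sum.swap) (simp add: root_sums_def sum_distrib_right)
    also have "\<dots> = 0" by (simp add: kernel)
    finally have "(\<Sum>t\<in>?T. f t * tree_vec (r (root_leaf t)) u) = 0" .
    moreover have "(\<Sum>t\<in>?T. f t * tree_vec t u) = f u"
    proof -
      have "(\<Sum>t\<in>?T. f t * tree_vec t u) = (\<Sum>t\<in>?T. if t = u then f t else 0)"
        by (rule sum.cong) (auto simp: tree_vec_def)
      then show ?thesis using f by simp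
    qed
    ultimately show ?thesis by (simp add: tree_diff_def right_diff_distrib sum_subtractf)
  qed
  ultimately show ?thesis by simp
qed

end

section \<open>The permutative operad as a quotient onto the partial tensor operad\<close>

lemma root_sums_linear:
  "root_sums n (\<lambda>t. f t + g t) j = root_sums n f j + root_sums n g j"
  "root_sums n (\<lambda>t. c * f t) j = c * root_sums n f j"
  by (auto simp: root_sums_def sum_distrib_left simp flip: sum.distrib intro!: sum.cong)

lemma root_sums_sum:
  "root_sums n (\<lambda>t. \<Sum>a\<in>A. f a t) j = (\<Sum>a\<in>A. root_sums n (f a) j)"
  unfolding root_sums_def by (subst sum.swap) (auto intro!: sum.cong)

lemma root_sums_surj:
  "root_sums n ` ops free_magmatic_operad n = carrier (function_space {1..n})"
proof
  show "root_sums n ` ops free_magmatic_operad n \<subseteq> carrier (function_space {1..n})"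
    using root_sums_outside by auto
  show "carrier (function_space {1..n}) \<subseteq> root_sums n ` ops free_magmatic_operad n"
  proof
    fix x assume x: "x \<in> carrier (function_space {1..n})"
    have "\<forall>j\<in>{1..n}. \<exists>t. t \<in> labelled_trees n \<and> root_leaf t = j" using exists_labelled_tree by metis
    then obtain r where r: "\<And>j. j \<in> {1..n} \<Longrightarrow> r j \<in> labelled_trees n \<and> root_leaf (r j) = j" by metis
    let ?f = "\<lambda>t. \<Sum>j = 1..n. x j * tree_vec (r j) t"
    have "?f t = 0" if "t \<notin> labelled_trees n" for t
      using r that by (intro sum.neutral) (auto simp: tree_vec_def)
    then have f: "?f \<in> ops free_magmatic_operad n" by simp
    have "root_sums n ?f i = x i" for i
    proof -
      have "root_sums n ?f i = (\<Sum>j = 1..n. x j * root_sums n (tree_vec (r j)) i)"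
        by (simp only: root_sums_sum root_sums_linear)
      also have "\<dots> = (\<Sum>j = 1..n. if j = i then x j else 0)"
      proof (rule sum.cong[OF refl])
        fix j assume "j \<in> {1..n}"
        then have "r j \<in> labelled_trees n" "root_leaf (r j) = j" using r by blast+
        then show "x j * root_sums n (tree_vec (r j)) i = (if j = i then x j else 0)"
          by (simp add: root_sums_tree_vec)
      qed
      also have "\<dots> = x i" using x by simp
      finally show ?thesis .
    qed
    then show "x \<in> root_sums n ` ops free_magmatic_operad n"
      using f by (intro image_eqI[of _ _ ?f]) auto
  qed
qed

interpretation free_to_tensor:
  operad_epimorphism partial_tensor_operad free_magmatic_operad root_sums
proof (intro operad_epimorphism.intro operad_partial_tensor operad_epimorphism_axioms.intro)
  fix n :: nat
  show "module real_field (opspace free_magmatic_operad n)" by (simp add: module_function_space)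
  show "linear_map (opspace free_magmatic_operad n) (opspace partial_tensor_operad n) (root_sums n)"
    by (rule linear_mapI) (simp_all add: root_sums_outside root_sums_linear fun_eq_iff)
  show "root_sums n ` ops free_magmatic_operad n = ops partial_tensor_operad n"
    using root_sums_surj by simp
next
  have "Leaf 1 \<in> labelled_trees 1" by (auto simp: labelled_trees_def)
  then show "opunit free_magmatic_operad \<in> ops free_magmatic_operad 1"
    "root_sums 1 (opunit free_magmatic_operad) = opunit partial_tensor_operad"
    using tree_vec_closed[of "Leaf 1" 1] root_sums_tree_vec[of "Leaf 1" 1] by auto
qed (simp_all only: free_act_closed free_comp_closed root_sums_act root_sums_comp
  partial_tensor_operad_simps fun_eq_iff simp_thms)

lemma perm_relators_empty: "n \<noteq> 3 \<Longrightarrow> perm_relators n = {}"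
  by (simp add: perm_relators_def Let_def)

lemma perm_relators_kern: "perm_relators n \<subseteq> free_to_tensor.kern n"
proof (cases "n = 3")
  case True
  have "tree_diff s t \<in> free_to_tensor.kern 3"
    if "s \<in> labelled_trees 3" "t \<in> labelled_trees 3" "root_leaf s = root_leaf t" for s t
  proof -
    have eq: "tree_diff s t = (\<lambda>u. tree_vec s u + (-1) * tree_vec t u)"
      by (simp add: tree_diff_def)
    have "root_sums 3 (tree_diff s t) j = 0" for j
      unfolding eq root_sums_linear root_sums_tree_vec[OF that(1)] root_sums_tree_vec[OF that(2)] that(3)
      by simp
    then have "root_sums 3 (tree_diff s t) = (\<lambda>j. 0)" by blast
    moreover have "tree_diff s t \<in> ops free_magmatic_operad 3"
      using that by (auto simp: tree_diff_def tree_vec_def)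
    ultimately show ?thesis by (simp add: free_to_tensor.fibre_def)
  qed
  then show ?thesis using labelled_trees_Node by (simp add: True perm_relators_eq)
qed (simp add: perm_relators_empty)

text \<open>
  The kernel is one of the ideals that the generated ideal intersects, and it is contained in each of them.
\<close>

lemma generated_ideal_eq_kern:
  assumes n: "n \<ge> 1"
  shows "generated_ideal free_magmatic_operad perm_relators n = free_to_tensor.kern n"
proof
  show "generated_ideal free_magmatic_operad perm_relators n \<subseteq> free_to_tensor.kern n"
    unfolding generated_ideal_def using free_to_tensor.operad_ideal_kern perm_relators_kern by blast
  show "free_to_tensor.kern n \<subseteq> generated_ideal free_magmatic_operad perm_relators n"
  proof
    fix f assume "f \<in> free_to_tensor.kern n"
    then have f: "f \<in> ops free_magmatic_operad n" "root_sums n f = (\<lambda>j. 0)"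
      by (simp_all add: free_to_tensor.fibre_def)
    have "f \<in> I n" if "operad_ideal free_magmatic_operad I" "\<forall>m\<ge>1. perm_relators m \<subseteq> I m" for I
    proof -
      have "perm_ideal I" using that by unfold_locales auto
      then show ?thesis using perm_ideal.kernel_subset_ideal n f by blast
    qed
    then show "f \<in> generated_ideal free_magmatic_operad perm_relators n"
      unfolding generated_ideal_def by blast
  qed
qed

theorem proposition7:
  shows "suboperad game_operad additive_games
    \<and> partial_tensor_operad \<cong>\<^sub>o\<^sub>p restrict_operad game_operad additive_games
    \<and> partial_tensor_operad \<cong>\<^sub>o\<^sub>p perm_operad
    \<and> restrict_operad game_operad additive_games \<cong>\<^sub>o\<^sub>p perm_operad"
proof -
  have perm: "operad perm_operad"
    unfolding perm_operad_def by (rule free_to_tensor.operad_quotient[OF generated_ideal_eq_kern])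
  have tensor_perm: "operad_iso partial_tensor_operad perm_operad free_to_tensor.fibre"
    unfolding perm_operad_def by (rule free_to_tensor.operad_iso_quotient[OF generated_ideal_eq_kern])
  note games_tensor = operad_iso_games_tensor
  have "operad_isomorphic partial_tensor_operad additive_game_operad"
    unfolding operad_isomorphic_def
    using operad_partial_tensor operad_additive_games
      operad_iso_inverse[OF operad_additive_games games_tensor] by blast
  moreover have "operad_isomorphic partial_tensor_operad perm_operad"
    unfolding operad_isomorphic_def using operad_partial_tensor perm tensor_perm by blast
  moreover have "operad_isomorphic additive_game_operad perm_operad"
    unfolding operad_isomorphic_def
    using operad_additive_games perm operad_iso_compose[OF games_tensor tensor_perm] by blast
  ultimately show ?thesis using suboperad_additive_games by blast
qed

end
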